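(* Fix $\alpha\in(0,1)$, integers $d\ge 1$, $b\ge 2$, $t\ge 0$, and a parameter set $\Theta\subset\mathbb{R}$. For $\theta\in\Theta$ let $g_\theta:(0,1)^d\to\mathbb{R}$ be measurable, and let $F$ denote the CDF of the random loss $L=g_\theta(\boldsymbol u)$ with $\boldsymbol u\sim \mathrm{Unif}((0,1)^d)$. Let $v_\alpha=v_\alpha(\theta)=\inf\{y\in\mathbb{R}:F(y)\ge\alpha\}$. Assume that for every $\theta\in\Theta$, $v_\alpha(\theta)$ is the unique solution $x$ of $F(x-)\le \alpha\le F(x)$. For each $m\ge t$ let $\boldsymbol u_1,\dots,\boldsymbol u_n$, $n=b^m$, be a scrambled $(t,m,d)$-net in base $b$, let $L_i=g_\theta(\boldsymbol u_i)$, $\hat F_n(y)=\frac1n\sum_{i=1}^n\mathbf 1\{L_i\le y\}$ and $\hat v_{\alpha,n}=\inf\{y\in\mathbb{R}:\hat F_n(y)\ge\alpha\}$. Then $$\mathbb{P}\Big(\lim_{n\to\infty}\hat v_{\alpha,n}=v_\alpha\Big)=1,$$ where $n=b^m\to\infty$ as $m\to\infty$.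
   Context: An elementary interval in base $b$ is a set $\prod_{j=1}^d[t_j b^{-k_j},(t_j+1)b^{-k_j})$ with nonnegative integers $k_j$ and $0\le t_j<b^{k_j}$. For integers $0\le t\le m$, a finite sequence $\boldsymbol u_1,\dots,\boldsymbol u_{b^m}\in[0,1)^d$ is a $(t,m,d)$-net in base $b$ if every elementary interval in base $b$ of volume $b^{t-m}$ contains exactly $b^t$ of the points. A scrambled net is obtained from a $(t,m,d)$-net by Owen's nested uniform scrambling: writing each coordinate $u_i^j=\sum_{k\ge1}a_{ijk}b^{-k}$ in base $b$, the scrambled coordinate is $\tilde u_i^j=\sum_{k\ge1}\tilde a_{ijk}b^{-k}$ with $\tilde a_{ij1}=\pi_j(a_{ij1})$ and in general $\tilde a_{ijk}=\pi_{j a_{ij1}\cdots a_{ij,k-1}}(a_{ijk})$, where the permutations $\pi_\bullet$ are mutually independent and each uniformly distributed over the $b!$ permutations of $\{0,\dots,b-1\}$. $F(x-)$ denotes the left limit of $F$ at $x$. *)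

theory Defs
  imports "HOL-Probability.Probability" "HOL-Combinatorics.Permutations"
begin

text \<open>Base-b digits: the k-th digit (k >= 1) of x in [0,1) is floor(b^k x) mod b
  (the standard expansion, not ending in infinitely many b-1).\<close>
definition digit :: "nat \<Rightarrow> nat \<Rightarrow> real \<Rightarrow> nat" where
  "digit b k x = nat (\<lfloor>x * real b ^ k\<rfloor> mod int b)"

definition elem_interval :: "nat \<Rightarrow> ('d \<Rightarrow> nat) \<Rightarrow> ('d \<Rightarrow> nat) \<Rightarrow> (real^'d) set" where
  "elem_interval b k c =
     {x. \<forall>j. real (c j) / real b ^ k j \<le> x$j \<and> x$j < real (c j + 1) / real b ^ k j}"

text \<open>(t,m,d)-net in base b, d = CARD('d), points P 0, ..., P (b^m - 1).
  An elementary interval has volume b^(-sum k), which equals b^(t-m) iff sum k = m - t.\<close>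
definition is_net :: "nat \<Rightarrow> nat \<Rightarrow> nat \<Rightarrow> (nat \<Rightarrow> real^'d) \<Rightarrow> bool" where
  "is_net b t m P \<longleftrightarrow> t \<le> m \<and>
     (\<forall>i<b^m. \<forall>j. 0 \<le> P i $ j \<and> P i $ j < 1) \<and>
     (\<forall>k c. (\<Sum>j\<in>UNIV. k j) = m - t \<longrightarrow> (\<forall>j. c j < b ^ k j) \<longrightarrow>
        card {i\<in>{..<b^m}. P i \<in> elem_interval b k c} = b ^ t)"

text \<open>Owen's nested uniform scrambling with permutations \<pi> indexed by (coordinate j,
  prefix of digits a_1..a_(k-1)).\<close>
definition scramble_coord :: "nat \<Rightarrow> ('d \<times> nat list \<Rightarrow> nat \<Rightarrow> nat) \<Rightarrow> 'd \<Rightarrow> real \<Rightarrow> real" where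
  "scramble_coord b \<pi> j x =
     (\<Sum>k. real (\<pi> (j, map (\<lambda>l. digit b l x) [1..<Suc k]) (digit b (Suc k) x)) / real b ^ Suc k)"

definition scramble :: "nat \<Rightarrow> ('d \<times> nat list \<Rightarrow> nat \<Rightarrow> nat) \<Rightarrow> real^'d \<Rightarrow> real^'d" where
  "scramble b \<pi> u = (\<chi> j. scramble_coord b \<pi> j (u $ j))"

definition perm_space :: "nat \<Rightarrow> ('d \<times> nat list \<Rightarrow> nat \<Rightarrow> nat) measure" where
  "perm_space b = PiM UNIV (\<lambda>_. measure_pmf (pmf_of_set {p. p permutes {..<b}}))"

definition unif_cdf :: "(real^'d \<Rightarrow> real) \<Rightarrow> real \<Rightarrow> real" where
  "unif_cdf h y = measure (uniform_measure lborel (box 0 One)) {u \<in> box 0 One. h u \<le> y}"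

definition left_lim :: "(real \<Rightarrow> real) \<Rightarrow> real \<Rightarrow> real" where
  "left_lim F x = Lim (at_left x) F"

definition quantile :: "real \<Rightarrow> (real \<Rightarrow> real) \<Rightarrow> real" where
  "quantile \<alpha> F = Inf {y. \<alpha> \<le> F y}"

definition emp_cdf :: "nat \<Rightarrow> (nat \<Rightarrow> real) \<Rightarrow> real \<Rightarrow> real" where
  "emp_cdf n L y = real (card {i\<in>{..<n}. L i \<le> y}) / real n"

end

theory Submission
  imports Defs
begin

text \<open>It suffices that the empirical measure of every Borel set \<open>A\<close> converges almost surely, because
  the uniqueness assumption says that the distribution function lies strictly below \<open>\<alpha>\<close> to the left
  of the quantile and strictly above \<open>\<alpha>\<close> to the right of it. No joint law of the scramblings for
  different \<open>m\<close> is given, so convergence has to come from summable second moments.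

  Write the indicator of \<open>A\<close> as \<open>p + h\<close>, where \<open>p\<close> is its orthogonal projection in \<open>L\<^sup>2\<close> onto the
  span of the indicators of all elementary intervals of volume \<open>b\<close> to the power \<open>t - m\<close>. Scrambling
  preserves the net property, so the net integrates \<open>p\<close> exactly. If there is a shape of such
  intervals for which two points lie in different digit cells in every coordinate, then conditionally
  on one scrambled point and on the cell of the other one, the latter is uniform in its elementary
  interval, on which \<open>h\<close> has mean zero; hence \<open>h\<close> is uncorrelated at the two scrambled points.
  The net property bounds the number of partners violating this, for a given point, by a power of
  \<open>m + 1\<close>, which gives a second moment of order \<open>(m + 1)\<close> to the power \<open>d\<close> times \<open>b\<close> to the power
  \<open>- m\<close>.\<close>

section \<open>Digit expansions and nested scrambling\<close>

lemma floor_mult_power_Suc: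
  assumes "2 \<le> b"
  shows "\<lfloor>x * real b ^ Suc K\<rfloor> = int b * \<lfloor>x * real b ^ K\<rfloor> + int (digit b (Suc K) x)"
proof -
  have "\<lfloor>x * real b ^ Suc K\<rfloor> div int b = \<lfloor>x * real b ^ K\<rfloor>"
    using floor_divide_real_eq_div[of "int b" "x * real b ^ Suc K"] assms by simp
  moreover have "int (digit b (Suc K) x) = \<lfloor>x * real b ^ Suc K\<rfloor> mod int b"
    using assms unfolding digit_def by simp
  ultimately show ?thesis
    by (metis mult_div_mod_eq)
qed

lemma digit_less: "2 \<le> b \<Longrightarrow> digit b k x < b"
  by (simp add: digit_def nat_less_iff)

text \<open>Uniqueness of quotient and remainder. It makes both encodings of a digit prefix, by
  floors and by \<open>digit_value\<close>, faithful.\<close>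

lemma mult_add_less_eq_iff:
  fixes p q b :: int
  assumes "0 \<le> r" "r < b" "0 \<le> s" "s < b"
  shows "b * p + r = b * q + s \<longleftrightarrow> p = q \<and> r = s"
proof
  assume *: "b * p + r = b * q + s"
  then have "(b * p + r) div b = (b * q + s) div b" by simp
  with assms have "p = q" by simp
  with * show "p = q \<and> r = s" by simp
qed auto

text \<open>This is the list that \<open>scramble_coord\<close> uses to index permutations: the
  digit with number \<open>K + 1\<close> is permuted by the member at the prefix of length
  \<open>K\<close>.\<close>

definition digit_prefix :: "nat \<Rightarrow> real \<Rightarrow> nat \<Rightarrow> nat list" where
  "digit_prefix b x K = map (\<lambda>l. digit b l x) [1..<Suc K]"

lemma length_digit_prefix [simp]: "length (digit_prefix b x K) = K"
  by (simp add: digit_prefix_def)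

lemma digit_prefix_Suc: "digit_prefix b x (Suc K) = digit_prefix b x K @ [digit b (Suc K) x]"
  by (simp add: digit_prefix_def)

lemma take_digit_prefix: "K \<le> L \<Longrightarrow> take K (digit_prefix b x L) = digit_prefix b x K"
  by (simp add: digit_prefix_def take_map take_upt del: upt_Suc)

text \<open>The floor at level \<open>K + 1\<close> is the floor at level \<open>K\<close> with one
  more base-\<open>b\<close> digit appended, so both sides grow in step. The range [0,1) makes both
  floors 0 at level 0.\<close>

lemma digit_prefix_eq_iff:
  assumes "2 \<le> b" "0 \<le> x" "x < 1" "0 \<le> y" "y < 1"
  shows "digit_prefix b x K = digit_prefix b y K \<longleftrightarrow> \<lfloor>x * real b ^ K\<rfloor> = \<lfloor>y * real b ^ K\<rfloor>"
proof (induction K)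
  case 0
  have "\<lfloor>x\<rfloor> = 0" "\<lfloor>y\<rfloor> = 0" using assms by linarith+
  then show ?case by (simp add: digit_prefix_def)
next
  case (Suc K)
  show ?case
    unfolding floor_mult_power_Suc[OF assms(1)] digit_prefix_Suc
    using mult_add_less_eq_iff[of "int (digit b (Suc K) x)" "int b" "int (digit b (Suc K) y)"]
      digit_less[OF assms(1)] Suc by simp
qed

text \<open>Horner evaluation of the first \<open>K\<close> digits, with \<open>d 0\<close> the most
  significant one.\<close>

fun digit_value :: "nat \<Rightarrow> (nat \<Rightarrow> nat) \<Rightarrow> nat \<Rightarrow> nat" where
  "digit_value b d 0 = 0"
| "digit_value b d (Suc K) = b * digit_value b d K + d K"

lemma digit_value_less:
  assumes "2 \<le> b" "\<And>k. d k < b"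
  shows "digit_value b d K < b ^ K"
proof (induction K)
  case (Suc K)
  have "b * digit_value b d K + d K < b * (digit_value b d K + 1)" using assms(2)[of K] by simp
  also have "\<dots> \<le> b * b ^ K" using Suc by (intro mult_left_mono) auto
  finally show ?case by simp
qed simp

lemma digit_value_eq_iff:
  assumes "2 \<le> b" "\<And>k. d k < b" "\<And>k. e k < b"
  shows "digit_value b d K = digit_value b e K \<longleftrightarrow> (\<forall>l<K. d l = e l)"
proof (induction K)
  case (Suc K)
  have "digit_value b d (Suc K) = digit_value b e (Suc K) \<longleftrightarrow>
      int b * int (digit_value b d K) + int (d K) = int b * int (digit_value b e K) + int (e K)"
    unfolding digit_value.simps by (metis of_nat_add of_nat_eq_iff of_nat_mult)
  also have "\<dots> \<longleftrightarrow> digit_value b d K = digit_value b e K \<and> d K = e K"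
    using mult_add_less_eq_iff[of "int (d K)" "int b" "int (e K)"] assms by simp
  finally show ?case using Suc by (auto simp: less_Suc_eq)
qed simp

text \<open>The digits come from repeated division by \<open>b\<close>: the remainder is the last
  digit and the quotient is expanded by induction.\<close>

lemma ex_digit_value_eq:
  assumes "2 \<le> b" "c < b ^ K"
  shows "\<exists>e. (\<forall>k. e k < b) \<and> digit_value b e K = c"
  using assms(2)
proof (induction K arbitrary: c)
  case 0
  then show ?case using assms(1) by (intro exI[of _ "\<lambda>_. 0"]) auto
next
  case (Suc K)
  have "c div b < b ^ K" using Suc.prems by (simp add: less_mult_imp_div_less mult.commute)
  from Suc.IH[OF this] obtain e where e: "\<forall>k. e k < b" "digit_value b e K = c div b" by blast
  define e' where "e' = e(K := c mod b)"
  have less: "\<forall>k. e' k < b" using e assms(1) by (simp add: e'_def)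
  moreover have "digit_value b e' K = digit_value b e K"
    using e less assms(1) by (subst digit_value_eq_iff) (auto simp: e'_def)
  moreover have "e' K = c mod b" by (simp add: e'_def)
  ultimately show ?case using e by (intro exI[of _ e']) simp
qed

text \<open>All three claims compare with the constant digit \<open>b - 1\<close>, whose series is
  geometric with sum 1. One smaller digit makes the inequality strict.\<close>

lemma digit_series:
  assumes "2 \<le> b" "\<And>k. d k < b"
  shows summable_digits: "summable (\<lambda>k. real (d k) / real b ^ Suc k)"
    and digit_series_nonneg: "0 \<le> (\<Sum>k. real (d k) / real b ^ Suc k)"
    and digit_series_less: "(\<exists>k. d k \<noteq> b - 1) \<Longrightarrow> (\<Sum>k. real (d k) / real b ^ Suc k) < 1"
proof -
  define g where "g k = (real b - 1) / real b ^ Suc k" for k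
  have "(\<lambda>k. (1 / real b) ^ k) sums (1 / (1 - 1 / real b))"
    using assms by (intro geometric_sums) auto
  then have "(\<lambda>k. (real b - 1) / real b * (1 / real b) ^ k) sums ((real b - 1) / real b * (1 / (1 - 1 / real b)))"
    by (rule sums_mult)
  moreover have "(real b - 1) / real b * (1 / (1 - 1 / real b)) = 1"
    using assms by (simp add: field_simps)
  moreover have "g = (\<lambda>k. (real b - 1) / real b * (1 / real b) ^ k)"
    by (simp add: g_def power_divide fun_eq_iff)
  ultimately have g: "g sums 1"
    by metis
  have le: "real (d k) / real b ^ Suc k \<le> g k" for k
    using assms(2)[of k] assms(1) unfolding g_def by (intro divide_right_mono) auto
  show s: "summable (\<lambda>k. real (d k) / real b ^ Suc k)"
    by (rule summable_comparison_test'[OF sums_summable[OF g], of 0]) (use le in auto)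
  show "0 \<le> (\<Sum>k. real (d k) / real b ^ Suc k)"
    by (rule suminf_nonneg[OF s]) simp
  assume "\<exists>k. d k \<noteq> b - 1"
  then obtain k where k: "d k \<noteq> b - 1" by blast
  have "real (d k) < real b - 1" using k assms(2)[of k] assms(1) by linarith
  then have lt: "real (d k) / real b ^ Suc k < g k"
    using assms(1) unfolding g_def by (intro divide_strict_right_mono) auto
  have "0 < (\<Sum>k. g k - real (d k) / real b ^ Suc k)"
    using s g le lt by (intro suminf_pos2[of _ k] summable_diff) (auto simp: sums_iff)
  also have "\<dots> = 1 - (\<Sum>k. real (d k) / real b ^ Suc k)"
    using s g by (subst suminf_diff[symmetric]) (auto simp: sums_iff)
  finally show "(\<Sum>k. real (d k) / real b ^ Suc k) < 1" by simp
qed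

lemma digit_series_mult_power:
  assumes "2 \<le> b" "\<And>k. d k < b"
  shows "(\<Sum>k. real (d k) / real b ^ Suc k) * real b ^ K =
    real (digit_value b d K) + (\<Sum>k. real (d (k + K)) / real b ^ Suc k)"
proof (induction K)
  case (Suc K)
  have s: "summable (\<lambda>k. real (d (k + K)) / real b ^ Suc k)"
    using summable_digits[of b "\<lambda>k. d (k + K)"] assms by simp
  have "(\<Sum>k. real (d (k + K)) / real b ^ Suc k) * real b =
      (\<Sum>k. real (d (Suc k + K)) / real b ^ Suc (Suc k)) * real b + real (d K)"
    using suminf_split_head[OF s] assms(1) by (simp add: field_simps)
  also have "(\<Sum>k. real (d (Suc k + K)) / real b ^ Suc (Suc k)) * real b =
      (\<Sum>k. real (d (k + Suc K)) / real b ^ Suc k)"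
    using assms(1) summable_ignore_initial_segment[OF s, of 1]
    by (subst suminf_mult2) (simp_all add: field_simps)
  finally have "(\<Sum>k. real (d (k + K)) / real b ^ Suc k) * real b =
      (\<Sum>k. real (d (k + Suc K)) / real b ^ Suc k) + real (d K)" .
  with Suc show ?case
    by (simp add: algebra_simps)
qed simp

text \<open>Multiplying by the \<open>K\<close>-th power of \<open>b\<close> shifts the first
  \<open>K\<close> digits into the integer part. Since the digits are not eventually
  \<open>b - 1\<close>, the remaining tail is strictly below 1 for every \<open>K\<close>.\<close>

lemma floor_digit_series:
  assumes "2 \<le> b" "\<And>k. d k < b" "\<And>L. \<exists>k\<ge>L. d k \<noteq> b - 1"
  shows "\<lfloor>(\<Sum>k. real (d k) / real b ^ Suc k) * real b ^ K\<rfloor> = int (digit_value b d K)"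
proof -
  obtain k where "k \<ge> K" "d k \<noteq> b - 1" using assms(3) by blast
  then have "\<exists>l. d (l + K) \<noteq> b - 1" by (intro exI[of _ "k - K"]) simp
  with digit_series_nonneg[of b "\<lambda>k. d (k + K)"] digit_series_less[of b "\<lambda>k. d (k + K)"] assms(1,2)
  show ?thesis
    unfolding digit_series_mult_power[OF assms(1,2)] by (simp add: floor_unique)
qed

text \<open>The scrambled digit with index \<open>k\<close> is the coefficient of \<open>b\<close> to the power \<open>- (k + 1)\<close>,
  so indices are shifted by one against \<^const>\<open>digit\<close>.\<close>

definition scrambled_digit :: "nat \<Rightarrow> ('d \<times> nat list \<Rightarrow> nat \<Rightarrow> nat) \<Rightarrow> 'd \<Rightarrow> real \<Rightarrow> nat \<Rightarrow> nat" where
  "scrambled_digit b \<pi> j x k = \<pi> (j, digit_prefix b x k) (digit b (Suc k) x)"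

lemma scramble_nth:
  "scramble b \<pi> u $ j = (\<Sum>k. real (scrambled_digit b \<pi> j (u $ j) k) / real b ^ Suc k)"
  by (simp add: scramble_def scramble_coord_def scrambled_digit_def digit_prefix_def)

lemma scrambled_digit_less:
  assumes "2 \<le> b" "\<forall>i. \<pi> i permutes {..<b}"
  shows "scrambled_digit b \<pi> j x k < b"
  using assms digit_less[OF assms(1), of "Suc k" x]
  unfolding scrambled_digit_def by (metis lessThan_iff permutes_in_image)

text \<open>As long as the prefixes agree, both points meet the same permutation, and its
  injectivity decides the next digit. Hence scrambling maps cells injectively to cells at each
  level.\<close>

lemma scrambled_digits_eq_iff:
  assumes "2 \<le> b" "\<forall>i. \<pi> i permutes {..<b}" "0 \<le> x" "x < 1" "0 \<le> y" "y < 1"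
  shows "(\<forall>l<K. scrambled_digit b \<pi> j x l = scrambled_digit b \<pi> j y l) \<longleftrightarrow>
    \<lfloor>x * real b ^ K\<rfloor> = \<lfloor>y * real b ^ K\<rfloor>"
  unfolding digit_prefix_eq_iff[OF assms(1,3-6), symmetric]
proof (induction K)
  case (Suc K)
  have "scrambled_digit b \<pi> j x K = scrambled_digit b \<pi> j y K \<longleftrightarrow> digit b (Suc K) x = digit b (Suc K) y"
    if "digit_prefix b x K = digit_prefix b y K"
    using that permutes_inj[OF assms(2)[rule_format]] by (auto simp: scrambled_digit_def inj_eq)
  with Suc show ?case by (auto simp: less_Suc_eq digit_prefix_Suc)
qed (simp add: digit_prefix_def)

text \<open>A scrambled expansion that ends in \<open>b - 1\<close> throughout is not the standard expansion of
  its value, so such permutations have to be discarded.\<close>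

definition regular_scrambling :: "nat \<Rightarrow> ('d \<times> nat list \<Rightarrow> nat \<Rightarrow> nat) \<Rightarrow> real^'d \<Rightarrow> bool" where
  "regular_scrambling b \<pi> x \<longleftrightarrow> (\<forall>i. \<pi> i permutes {..<b}) \<and>
     (\<forall>j L. \<exists>k\<ge>L. scrambled_digit b \<pi> j (x $ j) k \<noteq> b - 1)"

lemma floor_scramble:
  assumes "2 \<le> b" "regular_scrambling b \<pi> x"
  shows "\<lfloor>scramble b \<pi> x $ j * real b ^ K\<rfloor> = int (digit_value b (scrambled_digit b \<pi> j (x $ j)) K)"
  unfolding scramble_nth using assms
  by (intro floor_digit_series scrambled_digit_less) (auto simp: regular_scrambling_def)

lemma mem_elem_interval_iff:
  assumes "2 \<le> b"
  shows "x \<in> elem_interval b \<kappa> c \<longleftrightarrow> (\<forall>j. \<lfloor>x $ j * real b ^ \<kappa> j\<rfloor> = int (c j))"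
  using assms unfolding elem_interval_def by (simp add: floor_eq_iff field_simps)

definition unit_cube :: "(real^'d) set" where
  "unit_cube = {x. \<forall>j. 0 \<le> x $ j \<and> x $ j < 1}"

lemma scramble_mem_unit_cube:
  assumes "2 \<le> b" "regular_scrambling b \<pi> x"
  shows "scramble b \<pi> x \<in> unit_cube"
  using floor_scramble[OF assms, of _ 0] unfolding unit_cube_def by (simp add: floor_eq_iff)

lemma floor_mult_power_less:
  assumes "2 \<le> b" "0 \<le> x" "x < 1"
  shows "nat \<lfloor>x * real b ^ K\<rfloor> < b ^ K"
proof -
  have "x * real b ^ K < 1 * real b ^ K" using assms by (intro mult_strict_right_mono) auto
  then have "\<lfloor>x * real b ^ K\<rfloor> < int (b ^ K)" by (simp add: floor_less_iff)
  then show ?thesis using assms by (simp add: nat_less_iff)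
qed

text \<open>On each axis scrambling permutes the cells of level \<open>\<kappa> j\<close>: it acts
  injectively on a finite set of cells, hence is onto, and the cell \<open>c j\<close> has a
  preimage cell \<open>c' j\<close>. This is why scrambling preserves the net property.\<close>

lemma ex_elem_interval_preimage:
  fixes x :: "nat \<Rightarrow> real^'d"
  assumes "2 \<le> b" "\<And>i. i \<in> I \<Longrightarrow> regular_scrambling b \<pi> (x i)" "\<And>i. i \<in> I \<Longrightarrow> x i \<in> unit_cube"
    and perm: "\<forall>i. \<pi> i permutes {..<b}" and c: "\<And>j. c j < b ^ \<kappa> j"
  obtains c' where "\<And>j. c' j < b ^ \<kappa> j"
    "\<And>i. i \<in> I \<Longrightarrow> scramble b \<pi> (x i) \<in> elem_interval b \<kappa> c \<longleftrightarrow> x i \<in> elem_interval b \<kappa> c'"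
proof -
  \<comment> \<open>The cell with index \<open>a\<close> is represented by its left end point;
    \<open>T j a\<close> is the index of the cell to which it is sent.\<close>
  define T where "T j a = digit_value b (scrambled_digit b \<pi> j (real a / real b ^ \<kappa> j)) (\<kappa> j)" for j a
  have frac: "0 \<le> real a / real b ^ \<kappa> j" "real a / real b ^ \<kappa> j < 1" if "a < b ^ \<kappa> j" for a j
    using that assms(1) by (auto simp flip: of_nat_power)
  have fl: "\<lfloor>real a / real b ^ \<kappa> j * real b ^ \<kappa> j\<rfloor> = int a" for a j using assms(1) by simp
  have less: "scrambled_digit b \<pi> j y k < b" for j y k
    by (rule scrambled_digit_less[OF assms(1) perm])
  have "inj_on (T j) {..<b ^ \<kappa> j}" for j
  proof (rule inj_onI)
    fix p q assume pq: "p \<in> {..<b ^ \<kappa> j}" "q \<in> {..<b ^ \<kappa> j}" "T j p = T j q"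
    then show "p = q"
      unfolding T_def digit_value_eq_iff[OF assms(1) less less]
      using scrambled_digits_eq_iff[where j=j, OF assms(1) perm,
          of "real p / real b ^ \<kappa> j" "real q / real b ^ \<kappa> j" "\<kappa> j"]
        frac[of p j] frac[of q j] unfolding fl by simp
  qed
  moreover have "T j ` {..<b ^ \<kappa> j} \<subseteq> {..<b ^ \<kappa> j}" for j
    using digit_value_less[OF assms(1) less] by (auto simp: T_def)
  ultimately have "T j ` {..<b ^ \<kappa> j} = {..<b ^ \<kappa> j}" for j
    by (intro endo_inj_surj) auto
  then have "\<exists>a<b ^ \<kappa> j. T j a = c j" for j using c[of j] by (metis imageE lessThan_iff)
  then obtain c' where c': "\<And>j. c' j < b ^ \<kappa> j" "\<And>j. T j (c' j) = c j" by metis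
  show ?thesis
  proof (rule that[OF c'(1)])
    fix i assume i: "i \<in> I"
    then have x: "0 \<le> x i $ j" "x i $ j < 1" for j using assms(3) by (auto simp: unit_cube_def)
    have "digit_value b (scrambled_digit b \<pi> j (x i $ j)) (\<kappa> j) = c j \<longleftrightarrow>
        \<lfloor>x i $ j * real b ^ \<kappa> j\<rfloor> = int (c' j)" for j
      unfolding c'(2)[symmetric] T_def digit_value_eq_iff[OF assms(1) less less]
      using scrambled_digits_eq_iff[where j=j and K="\<kappa> j", OF assms(1) perm x(1)[of j] x(2)[of j] frac[OF c'(1)[of j]]] fl by (simp only:)
    then show "scramble b \<pi> (x i) \<in> elem_interval b \<kappa> c \<longleftrightarrow> x i \<in> elem_interval b \<kappa> c'"
      unfolding mem_elem_interval_iff[OF assms(1)] floor_scramble[OF assms(1) assms(2)[OF i]] by simp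
  qed
qed

lemma card_scrambled_net:
  assumes "2 \<le> b" "is_net b t m x" "\<And>i. i < b ^ m \<Longrightarrow> regular_scrambling b \<pi> (x i)"
    "(\<Sum>j\<in>UNIV. \<kappa> j) = m - t" "\<And>j. c j < b ^ \<kappa> j"
  shows "card {i\<in>{..<b ^ m}. scramble b \<pi> (x i) \<in> elem_interval b \<kappa> c} = b ^ t"
proof -
  have perm: "\<forall>i. \<pi> i permutes {..<b}"
    using assms(3)[of 0] assms(1) by (simp add: regular_scrambling_def)
  obtain c' where c': "\<And>j. c' j < b ^ \<kappa> j"
    "\<And>i. i \<in> {..<b ^ m} \<Longrightarrow> scramble b \<pi> (x i) \<in> elem_interval b \<kappa> c \<longleftrightarrow> x i \<in> elem_interval b \<kappa> c'"
    using ex_elem_interval_preimage[OF assms(1), of "{..<b ^ m}" \<pi> x c \<kappa>] assms(2,3) perm assms(5)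
    by (auto simp: is_net_def unit_cube_def)
  then have "{i\<in>{..<b ^ m}. scramble b \<pi> (x i) \<in> elem_interval b \<kappa> c} =
      {i\<in>{..<b ^ m}. x i \<in> elem_interval b \<kappa> c'}" by auto
  then show ?thesis using assms(2,4) c'(1) by (simp add: is_net_def)
qed

section \<open>The space of random permutations\<close>

abbreviation perm_pmf :: "nat \<Rightarrow> (nat \<Rightarrow> nat) pmf" where
  "perm_pmf b \<equiv> pmf_of_set {p. p permutes {..<b}}"

lemma perms_finite_nonempty: "finite {p. p permutes {..<b::nat}}" "{p. p permutes {..<b::nat}} \<noteq> {}"
  by (auto intro: finite_permutations permutes_id)

text \<open>Composing with the transposition of \<open>c\<close> and \<open>c'\<close> leaves the
  uniform distribution invariant. The claim is symmetric in \<open>c\<close> and \<open>c'\<close>,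
  so the inequality yields equality.\<close>

lemma prob_perm_apply_swap:
  assumes "c < b" "c' < b"
  shows "measure (perm_pmf b) {p. p a = c} \<le> measure (perm_pmf b) {p. p a = c'}"
proof -
  let ?T = "\<lambda>p. Transposition.transpose c c' \<circ> p"
  have T: "Transposition.transpose c c' permutes {..<b}"
    using assms by (intro permutes_swap_id) auto
  have "bij_betw ?T {p. p permutes {..<b}} {p. p permutes {..<b}}"
    by (rule bij_betw_byWitness[of _ ?T])
      (auto simp: o_assoc[symmetric] fun_eq_iff intro: permutes_compose[OF _ T])
  then have "map_pmf ?T (perm_pmf b) = perm_pmf b"
    using perms_finite_nonempty by (intro map_pmf_of_set_bij_betw) auto
  then have "measure (perm_pmf b) {p. p a = c'} = measure (perm_pmf b) (?T -` {p. p a = c'})"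
    by (metis measure_map_pmf)
  also have "?T -` {p. p a = c'} = {p. p a = c}"
    by (auto simp: transpose_eq_iff)
  finally show ?thesis by simp
qed

lemma prob_perm_apply:
  assumes "a < b" "c < b"
  shows "measure (perm_pmf b) {p. p a = c} = 1 / real b"
proof -
  have "1 = measure (perm_pmf b) (\<Union>c'\<in>{..<b}. {p. p a = c'})"
  proof -
    have "AE p in perm_pmf b. p \<in> (\<Union>c'\<in>{..<b}. {p. p a = c'})"
      using assms(1) perms_finite_nonempty
      by (auto simp: AE_measure_pmf_iff dest: permutes_in_image[of _ _ a])
    then show ?thesis by (subst (asm) measure_pmf.prob_eq_1[symmetric]) auto
  qed
  also have "\<dots> = (\<Sum>c'<b. measure (perm_pmf b) {p. p a = c'})"
    by (intro measure_pmf.finite_measure_finite_Union) (auto simp: disjoint_family_on_def)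
  also have "\<dots> = (\<Sum>c'<b. measure (perm_pmf b) {p. p a = c})"
    using assms(2) by (intro sum.cong order.antisym prob_perm_apply_swap) auto
  finally show ?thesis using assms by (simp add: field_simps)
qed

lemma product_prob_space_perm: "product_prob_space (\<lambda>_. measure_pmf (perm_pmf b))"
  by unfold_locales

lemma prob_space_perm_space: "prob_space (perm_space b)"
  unfolding perm_space_def by (intro prob_space_PiM measure_pmf.prob_space_axioms)

lemma space_perm_space [simp]: "space (perm_space b) = UNIV"
  by (simp add: perm_space_def space_PiM)

lemma measurable_perm_space_apply:
  "(\<lambda>\<pi>. f (\<pi> i)) \<in> borel_measurable (perm_space b)"
proof -
  have "(\<lambda>\<pi>. \<pi> i) \<in> measurable (perm_space b) (measure_pmf (perm_pmf b))"
    unfolding perm_space_def by (rule measurable_component_singleton) simp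
  then show ?thesis by (rule measurable_compose) simp
qed

lemma measurable_scramble [measurable]:
  fixes x :: "real^'d"
  shows "(\<lambda>\<pi>. scramble b \<pi> x) \<in> borel_measurable (perm_space b)"
proof (rule borel_measurable_euclidean_space[THEN iffD2], rule ballI)
  fix i :: "real^'d" assume "i \<in> Basis"
  then obtain j where "i = axis j 1" by (auto simp: Basis_vec_def)
  then have "scramble b \<pi> x \<bullet> i = (\<Sum>k. real (scrambled_digit b \<pi> j (x $ j) k) / real b ^ Suc k)" for \<pi>
    by (simp add: inner_axis scramble_nth)
  moreover have "(\<lambda>\<pi>. \<Sum>k. real (scrambled_digit b \<pi> j (x $ j) k) / real b ^ Suc k) \<in> borel_measurable (perm_space b)"
    unfolding scrambled_digit_def
    by (intro borel_measurable_suminf borel_measurable_divide borel_measurable_const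
        measurable_perm_space_apply[where f="\<lambda>p. real (p _)"])
  ultimately show "(\<lambda>\<pi>. scramble b \<pi> x \<bullet> i) \<in> borel_measurable (perm_space b)" by simp
qed

text \<open>Different pairs \<open>(j, l)\<close> use different permutations, since their prefixes
  differ in length or belong to different coordinates. The digits of one scrambled point are
  therefore independent, and each is uniform.\<close>

lemma emeasure_scrambled_digits:
  fixes x :: "real^'d" and F :: "('d \<times> nat) set"
  assumes "2 \<le> b" "finite F" "\<And>j l. e j l < b"
  shows "emeasure (perm_space b) {\<pi>. \<forall>(j, l)\<in>F. scrambled_digit b \<pi> j (x $ j) l = e j l}
    = ennreal (1 / real b ^ card F)"
proof -
  interpret product_prob_space "\<lambda>_. measure_pmf (perm_pmf b)" UNIV
    by (rule product_prob_space_perm)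
  define \<iota> where "\<iota> = (\<lambda>(j, l). (j, digit_prefix b (x $ j) l))"
  have inj: "inj \<iota>"
    unfolding \<iota>_def by (rule injI) (auto dest: arg_cong[of _ _ length])
  \<comment> \<open>The digit position is recovered from the index as the length of the
    prefix.\<close>
  define X where "X = (\<lambda>(j, p::nat list). {q. q (digit b (Suc (length p)) (x $ j)) = e j (length p)})"
  have "{\<pi>. \<forall>(j, l)\<in>F. scrambled_digit b \<pi> j (x $ j) l = e j l} =
      {\<pi>\<in>space (PiM UNIV (\<lambda>_. measure_pmf (perm_pmf b))). \<forall>i\<in>\<iota> ` F. \<pi> i \<in> X i}"
    by (auto simp: space_PiM \<iota>_def X_def scrambled_digit_def)
  then have "emeasure (perm_space b) {\<pi>. \<forall>(j, l)\<in>F. scrambled_digit b \<pi> j (x $ j) l = e j l}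
      = (\<Prod>i\<in>\<iota> ` F. emeasure (perm_pmf b) (X i))"
    using assms(2) unfolding perm_space_def by (subst emeasure_PiM_Collect[symmetric]) auto
  also have "\<dots> = (\<Prod>i\<in>\<iota> ` F. ennreal (1 / real b))"
  proof (intro prod.cong refl)
    fix i assume "i \<in> \<iota> ` F"
    then obtain j l where "i = \<iota> (j, l)" by auto
    then show "emeasure (perm_pmf b) (X i) = ennreal (1 / real b)"
      using assms(1,3) by (simp add: \<iota>_def X_def measure_pmf.emeasure_eq_measure prob_perm_apply digit_less)
  qed
  also have "\<dots> = ennreal (1 / real b ^ card F)"
    using inj by (simp add: card_image inj_on_subset[OF inj] ennreal_power power_divide)
  finally show ?thesis .
qed

lemma AE_perm_space_permutes: "AE \<pi> in perm_space b. \<forall>i::'d::finite \<times> nat list. \<pi> i permutes {..<b}"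
proof -
  interpret product_prob_space "\<lambda>_::'d \<times> nat list. measure_pmf (perm_pmf b)" UNIV
    by (rule product_prob_space_perm)
  have "AE \<pi> in perm_space b. \<pi> i permutes {..<b}" for i :: "'d \<times> nat list"
    unfolding perm_space_def
    by (rule AE_component) (use perms_finite_nonempty in \<open>auto simp: AE_measure_pmf_iff\<close>)
  then show ?thesis by (simp add: AE_all_countable)
qed

text \<open>A run of \<open>n\<close> scrambled digits \<open>b - 1\<close> from position
  \<open>L\<close> on has probability \<open>b\<close> to the power \<open>- n\<close>, so an
  infinite run has probability 0. Only countably many \<open>j\<close> and \<open>L\<close>
  occur.\<close>

lemma AE_regular_scrambling:
  fixes x :: "real^'d"
  assumes "2 \<le> b"
  shows "AE \<pi> in perm_space b. regular_scrambling b \<pi> x"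
proof -
  have "AE \<pi> in perm_space b. \<exists>k\<ge>L. scrambled_digit b \<pi> j (x $ j) k \<noteq> b - 1" for j L
  proof (rule AE_I')
    let ?N = "{\<pi>. \<forall>k\<ge>L. scrambled_digit b \<pi> j (x $ j) k = b - 1}"
    have meas: "?N \<in> sets (perm_space b)"
    proof -
      have "(\<lambda>\<pi>. real (scrambled_digit b \<pi> j (x $ j) k)) \<in> borel_measurable (perm_space b)" for k
        unfolding scrambled_digit_def by (rule measurable_perm_space_apply[where f="\<lambda>p. real (p _)"])
      note [measurable] = this
      have "{\<pi>\<in>space (perm_space b). \<forall>k\<ge>L. real (scrambled_digit b \<pi> j (x $ j) k) = real (b - 1)} \<in> sets (perm_space b)"
        by measurable
      then show ?thesis by (simp only: of_nat_eq_iff space_perm_space UNIV_I simp_thms)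
    qed
    have "emeasure (perm_space b) ?N \<le> ennreal ((1 / real b) ^ n)" for n
    proof -
      let ?F = "(\<lambda>l. (j, l)) ` {L..<L + n}"
      have "emeasure (perm_space b) ?N \<le>
          emeasure (perm_space b) {\<pi>. \<forall>(j', l)\<in>?F. scrambled_digit b \<pi> j' (x $ j') l = b - 1}"
      proof (rule emeasure_mono)
        \<comment> \<open>Sets that are not measurable get measure 0, so the positive value already
          known for this event proves its measurability.\<close>
        show "{\<pi>. \<forall>(j', l)\<in>?F. scrambled_digit b \<pi> j' (x $ j') l = b - 1} \<in> sets (perm_space b)"
          using emeasure_scrambled_digits[OF assms, of ?F "\<lambda>_ _. b - 1" x] assms
          by (intro emeasure_neq_0_sets) (auto simp: ennreal_eq_0_iff divide_le_0_iff not_le)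
      qed auto
      also have "\<dots> = ennreal ((1 / real b) ^ n)"
        using assms by (subst emeasure_scrambled_digits) (auto simp: card_image inj_on_def power_divide)
      finally show ?thesis .
    qed
    moreover have "(\<lambda>n. ennreal ((1 / real b) ^ n)) \<longlonglongrightarrow> ennreal 0"
      using assms by (intro tendsto_ennrealI LIMSEQ_power_zero) auto
    ultimately have "emeasure (perm_space b) ?N \<le> 0"
      by (intro LIMSEQ_le_const[of _ 0]) (auto simp: ennreal_0)
    with meas show "?N \<in> null_sets (perm_space b)" by auto
  qed auto
  then have "AE \<pi> in perm_space b. \<forall>j L. \<exists>k\<ge>L. scrambled_digit b \<pi> j (x $ j) k \<noteq> b - 1"
    by (simp add: AE_all_countable AE_finite_all[of UNIV, simplified])
  with AE_perm_space_permutes show ?thesis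
    unfolding regular_scrambling_def by eventually_elim auto
qed

section \<open>Volumes of elementary intervals and the uniform distribution on the half-open
  cube\<close>

lemma emeasure_lborel_half_open_box:
  fixes l u :: "'d::finite \<Rightarrow> real"
  assumes "\<And>j. l j < u j"
  shows "emeasure lborel {x::real^'d. \<forall>j. l j \<le> x $ j \<and> x $ j < u j} = ennreal (\<Prod>j\<in>UNIV. u j - l j)"
    "{x::real^'d. \<forall>j. l j \<le> x $ j \<and> x $ j < u j} \<in> sets borel"
proof -
  let ?l = "\<chi> j. l j" and ?u = "\<chi> j. u j" and ?S = "{x::real^'d. \<forall>j. l j \<le> x $ j \<and> x $ j < u j}"
  show S: "?S \<in> sets borel"
  proof -
    have "?S = (\<Inter>j\<in>UNIV. {x. l j \<le> x $ j} \<inter> {x. x $ j < u j})" by auto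
    also have "\<dots> \<in> sets borel"
      by (intro sets.finite_INT sets.Int borel_closed borel_open closed_halfspace_component_ge_cart
          open_halfspace_component_lt_cart) auto
    finally show ?thesis .
  qed
  have lt: "?l \<bullet> i \<le> ?u \<bullet> i" if "i \<in> Basis" for i
    using that assms by (auto simp: Basis_vec_def inner_axis less_imp_le)
  have ne: "cbox ?l ?u \<noteq> {}" using assms by (auto simp: interval_ne_empty_cart less_imp_le)
  have cb: "emeasure lborel (cbox ?l ?u) = ennreal (\<Prod>j\<in>UNIV. u j - l j)"
    using content_cbox_cart[OF ne] emeasure_eq_ennreal_measure[of lborel "cbox ?l ?u"]
      emeasure_lborel_cbox_finite[of ?l ?u] by (simp add: less_top)
  \<comment> \<open>The half-open box lies between the open and the closed box, which have equal
    volume.\<close>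
  have "emeasure lborel (box ?l ?u) \<le> emeasure lborel ?S"
    using S by (intro emeasure_mono) (auto simp: mem_box_cart less_imp_le)
  moreover have "emeasure lborel ?S \<le> emeasure lborel (cbox ?l ?u)"
    using S by (intro emeasure_mono) (auto simp: mem_box_cart less_imp_le)
  moreover have "emeasure lborel (box ?l ?u) = emeasure lborel (cbox ?l ?u)"
    using lt by (simp add: emeasure_lborel_box_eq emeasure_lborel_cbox_eq)
  ultimately show "emeasure lborel ?S = ennreal (\<Prod>j\<in>UNIV. u j - l j)"
    using cb by (simp only: order.antisym)
qed

lemma elem_interval_sets [measurable]: "2 \<le> b \<Longrightarrow> elem_interval b \<kappa> c \<in> sets borel"
  unfolding elem_interval_def by (rule emeasure_lborel_half_open_box) (simp add: divide_strict_right_mono)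

lemma emeasure_lborel_elem_interval:
  assumes "2 \<le> b"
  shows "emeasure lborel (elem_interval b \<kappa> c) = ennreal (1 / real b ^ (\<Sum>j\<in>UNIV. \<kappa> j))"
proof -
  have "(\<Prod>j\<in>UNIV. real (c j + 1) / real b ^ \<kappa> j - real (c j) / real b ^ \<kappa> j) = (\<Prod>j\<in>UNIV. 1 / real b ^ \<kappa> j)"
    by (intro prod.cong) (auto simp: diff_divide_distrib[symmetric])
  also have "\<dots> = 1 / real b ^ (\<Sum>j\<in>UNIV. \<kappa> j)"
    by (simp add: power_sum prod_dividef)
  finally show ?thesis
    unfolding elem_interval_def using assms
    by (subst emeasure_lborel_half_open_box) (auto intro: divide_strict_right_mono)
qed

lemma unit_cube_sets [measurable]: "unit_cube \<in> sets borel"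
  unfolding unit_cube_def by (rule emeasure_lborel_half_open_box) simp

lemma emeasure_unit_cube: "emeasure lborel (unit_cube :: (real^'d) set) = 1"
  unfolding unit_cube_def by (subst emeasure_lborel_half_open_box) auto

lemma elem_interval_subset_unit_cube:
  assumes "2 \<le> b" "\<And>j. c j < b ^ \<kappa> j"
  shows "elem_interval b \<kappa> c \<subseteq> unit_cube"
proof
  fix x assume x: "x \<in> elem_interval b \<kappa> c"
  show "x \<in> unit_cube" unfolding unit_cube_def
  proof (intro CollectI allI conjI)
    fix j
    have "0 \<le> real (c j) / real b ^ \<kappa> j" by simp
    also have "\<dots> \<le> x $ j" using x by (simp add: elem_interval_def)
    finally show "0 \<le> x $ j" .
    have "x $ j < real (c j + 1) / real b ^ \<kappa> j" using x by (simp add: elem_interval_def)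
    also have "\<dots> \<le> 1"
      using assms(1) assms(2)[of j] by (simp add: divide_le_eq flip: of_nat_power)
    finally show "x $ j < 1" .
  qed
qed

text \<open>The half-open cube is the disjoint union of the elementary intervals of any fixed shape.
  It differs from \<open>box 0 One\<close> only by a null set, which \<open>AE_unif_box\<close>
  bridges.\<close>

abbreviation unif :: "(real^'d) measure" where
  "unif \<equiv> uniform_measure lborel unit_cube"

lemma prob_space_unif: "prob_space unif"
  by (rule prob_space_uniform_measure) (auto simp: emeasure_unit_cube)

lemma emeasure_unif: "A \<in> sets borel \<Longrightarrow> A \<subseteq> unit_cube \<Longrightarrow> emeasure unif A = emeasure lborel A"
  by (simp add: emeasure_unit_cube Int_absorb1 divide_ennreal_def)

section \<open>A scrambled point is uniformly distributed\<close>

lemma floor_mult_power_div: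
  assumes "2 \<le> b" "K \<le> L"
  shows "\<lfloor>y * real b ^ K\<rfloor> = \<lfloor>y * real b ^ L\<rfloor> div int (b ^ (L - K))"
proof -
  have "real b ^ L = real b ^ K * real b ^ (L - K)"
    using assms(2) by (simp flip: power_add)
  then have "y * real b ^ L / real_of_int (int (b ^ (L - K))) = y * real b ^ K"
    using assms(1) by simp
  then show ?thesis using floor_divide_real_eq_div[of "int (b ^ (L - K))" "y * real b ^ L"] by simp
qed

text \<open>Integer indices let the cubes tile the whole space, so that they cover it and generate
  its Borel sets.\<close>

definition grid_cube :: "nat \<Rightarrow> nat \<Rightarrow> ('d \<Rightarrow> int) \<Rightarrow> (real^'d) set" where
  "grid_cube b K c = {x. \<forall>j. \<lfloor>x $ j * real b ^ K\<rfloor> = c j}"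

lemma grid_cube_sets: "2 \<le> b \<Longrightarrow> grid_cube b K c \<in> sets borel"
proof -
  assume b: "2 \<le> b"
  have "grid_cube b K c = {x. \<forall>j. real_of_int (c j) / real b ^ K \<le> x $ j \<and> x $ j < real_of_int (c j + 1) / real b ^ K}"
    using b unfolding grid_cube_def by (simp add: floor_eq_iff field_simps)
  also have "\<dots> \<in> sets borel"
    using b by (intro emeasure_lborel_half_open_box) (simp add: divide_strict_right_mono)
  finally show ?thesis .
qed

text \<open>Two cubes of this kind are nested or disjoint, because the floors at a finer level
  determine those at a coarser one. The empty set is added for the disjoint case.\<close>

lemma Int_stable_grid_cubes:
  assumes "2 \<le> b"
  shows "Int_stable (insert {} (range (\<lambda>(K, c :: 'd::finite \<Rightarrow> int). grid_cube b K c)))"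
proof -
  have *: "grid_cube b K c \<inter> grid_cube b L c' \<in> {{}, grid_cube b L c'}" if "K \<le> L" for K L and c c' :: "'d \<Rightarrow> int"
  proof (cases "grid_cube b K c \<inter> grid_cube b L c' = {}")
    case False
    then obtain z where z: "z \<in> grid_cube b K c" "z \<in> grid_cube b L c'" by auto
    have "grid_cube b L c' \<subseteq> grid_cube b K c"
      using z unfolding grid_cube_def by (auto simp: floor_mult_power_div[OF assms that])
    then show ?thesis by auto
  qed simp
  have "grid_cube b K c \<inter> grid_cube b L c' \<in> {{}, grid_cube b K c, grid_cube b L c'}" for K L and c c' :: "'d \<Rightarrow> int"
    using *[of K L c c'] *[of L K c' c] by (cases "K \<le> L") (auto simp: Int_commute)
  note * = this
  have "grid_cube b K c \<in> range (\<lambda>(K, c). grid_cube b K c)" for K and c :: "'d \<Rightarrow> int" by auto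
  then have **: "grid_cube b K c \<inter> grid_cube b L c' \<in> insert {} (range (\<lambda>(K, c). grid_cube b K c))" for K L and c c' :: "'d \<Rightarrow> int"
    using *[of K c L c'] by auto
  show ?thesis
  proof (rule Int_stableI)
    fix A B :: "(real^'d) set" assume AB: "A \<in> insert {} (range (\<lambda>(K, c :: 'd \<Rightarrow> int). grid_cube b K c))"
      "B \<in> insert {} (range (\<lambda>(K, c). grid_cube b K c))"
    show "A \<inter> B \<in> insert {} (range (\<lambda>(K, c). grid_cube b K c))"
    proof (cases "A = {} \<or> B = {}")
      case False
      with AB obtain p q where "A = grid_cube b (fst p) (snd p)" "B = grid_cube b (fst q) (snd q)"
        by (auto simp: split_beta)
      then show ?thesis using **[of "fst p" "snd p" "fst q" "snd q"] by (simp only:)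
    qed auto
  qed
qed

lemma sets_borel_eq_grid_cubes:
  assumes "2 \<le> b"
  shows "sets (borel :: (real^'d) measure) = sigma_sets UNIV (insert {} (range (\<lambda>(K, c). grid_cube b K c)))"
    (is "_ = sigma_sets UNIV ?E")
proof -
  have "sigma_sets UNIV {S :: (real^'d) set. open S} = sigma_sets UNIV ?E"
  proof (rule sigma_sets_eqI)
    fix S :: "(real^'d) set" assume "S \<in> {S. open S}"
    then have S: "open S" by simp
    define I where "I = {(K, c). grid_cube b K c \<subseteq> S}"
    \<comment> \<open>The index set of all cubes is countable, so this union stays in the
      sigma-algebra.\<close>
    have "S = (\<Union>(K, c)\<in>I. grid_cube b K c)"
    proof
      show "S \<subseteq> (\<Union>(K, c)\<in>I. grid_cube b K c)"
      proof
        fix z assume "z \<in> S"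
        with S obtain e where e: "0 < e" "ball z e \<subseteq> S" by (meson open_contains_ball)
        \<comment> \<open>Two points of one cube of level \<open>K\<close> differ by at most
          \<open>b\<close> to the power \<open>- K\<close> in each coordinate, hence in norm by at
          most \<open>CARD('d)\<close> times that.\<close>
        have "(\<lambda>K. real CARD('d) * (1 / real b) ^ K) \<longlonglongrightarrow> real CARD('d) * 0"
          using assms by (intro tendsto_mult tendsto_const LIMSEQ_power_zero) auto
        then have "\<forall>\<^sub>F K in sequentially. real CARD('d) * (1 / real b) ^ K < e"
          using e by (intro order_tendstoD(2)) auto
        then obtain K where K: "real CARD('d) * (1 / real b) ^ K < e"
          using eventually_happens'[OF sequentially_bot] by blast
        define c where "c j = \<lfloor>z $ j * real b ^ K\<rfloor>" for j
        have "y \<in> ball z e" if "y \<in> grid_cube b K c" for y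
        proof -
          have "\<bar>(z - y) $ j\<bar> \<le> (1 / real b) ^ K" for j
          proof -
            have "\<lfloor>z $ j * real b ^ K\<rfloor> = \<lfloor>y $ j * real b ^ K\<rfloor>"
              using that by (simp add: grid_cube_def c_def)
            then have "\<bar>z $ j * real b ^ K - y $ j * real b ^ K\<bar> \<le> 1" by linarith
            also have "z $ j * real b ^ K - y $ j * real b ^ K = (z - y) $ j * real b ^ K"
              by (simp add: algebra_simps)
            finally have "\<bar>(z - y) $ j\<bar> * real b ^ K \<le> 1" by (simp add: abs_mult)
            then show ?thesis using assms by (simp add: power_divide pos_le_divide_eq)
          qed
          then have "(\<Sum>j\<in>UNIV. \<bar>(z - y) $ j\<bar>) \<le> (\<Sum>j\<in>(UNIV::'d set). (1 / real b) ^ K)"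
            by (intro sum_mono)
          with norm_le_l1_cart[of "z - y"] K show ?thesis by (simp add: dist_norm)
        qed
        then have "(K, c) \<in> I" using e(2) by (auto simp: I_def)
        moreover have "z \<in> grid_cube b K c" by (simp add: grid_cube_def c_def)
        ultimately show "z \<in> (\<Union>(K, c)\<in>I. grid_cube b K c)" by blast
      qed
    qed (auto simp: I_def)
    also have "\<dots> \<in> sigma_sets UNIV ?E"
      by (intro sigma_sets_UNION) (auto intro: sigma_sets.Basic)
    finally show "S \<in> sigma_sets UNIV ?E" .
  next
    fix S assume "S \<in> ?E"
    then have "S \<in> sets borel" using grid_cube_sets[OF assms] by auto
    then show "S \<in> sigma_sets UNIV {S. open S}" by (simp add: borel_def)
  qed
  then show ?thesis by (simp add: borel_def)
qed

lemma measure_eqI_grid_cubes: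
  fixes M N :: "(real^'d) measure"
  assumes "2 \<le> b" "finite_measure M" "sets M = sets borel" "sets N = sets borel"
    and "\<And>K c. emeasure M (grid_cube b K c) = emeasure N (grid_cube b K c)"
  shows "M = N"
proof (rule measure_eqI_generator_eq[OF Int_stable_grid_cubes[OF assms(1)]])
  interpret finite_measure M by fact
  \<comment> \<open>The cubes of side 1, enumerated by \<open>from_nat\<close>, are the countable
    cover by sets of finite measure that uniqueness of measures asks for.\<close>
  show "range (\<lambda>i. grid_cube b 0 (from_nat i)) \<subseteq> insert {} (range (\<lambda>(K, c :: 'd \<Rightarrow> int). grid_cube b K c))" by auto
  show "(\<Union>i. grid_cube b 0 (from_nat i)) = (UNIV :: (real^'d) set)"
  proof (rule UNIV_eq_I[symmetric])
    fix x :: "real^'d"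
    show "x \<in> (\<Union>i. grid_cube b 0 (from_nat i))"
      by (rule UN_I[of "to_nat (\<lambda>j. \<lfloor>x $ j\<rfloor>)"]) (simp_all add: grid_cube_def)
  qed
  show "emeasure M (grid_cube b 0 (from_nat i)) \<noteq> \<infinity>" for i by simp
qed (use assms sets_borel_eq_grid_cubes[OF assms(1)] in auto)

text \<open>Landing in a grid cube inside the unit cube prescribes the first \<open>K\<close>
  scrambled digits of every coordinate, an event whose probability is the volume of the cube. Grid
  cubes outside have measure 0 on both sides.\<close>

lemma distr_scramble:
  fixes x :: "real^'d"
  assumes "2 \<le> b"
  shows "distr (perm_space b) borel (\<lambda>\<pi>. scramble b \<pi> x) = unif"
proof (rule measure_eqI_grid_cubes[OF assms])
  interpret prob_space "perm_space b" by (rule prob_space_perm_space)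
  interpret D: prob_space "distr (perm_space b) borel (\<lambda>\<pi>. scramble b \<pi> x)"
    by (rule prob_space_distr) simp
  show "finite_measure (distr (perm_space b) borel (\<lambda>\<pi>. scramble b \<pi> x))" by unfold_locales
  fix K and c :: "'d \<Rightarrow> int"
  have sets: "grid_cube b K c \<in> sets borel" by (rule grid_cube_sets[OF assms])
  have N: "emeasure (distr (perm_space b) borel (\<lambda>\<pi>. scramble b \<pi> x)) (grid_cube b K c) =
      emeasure (perm_space b) {\<pi>. scramble b \<pi> x \<in> grid_cube b K c}"
    using sets by (subst emeasure_distr) (auto intro: arg_cong2[where f=emeasure])
  have meas: "{\<pi>. scramble b \<pi> x \<in> grid_cube b K c} \<in> sets (perm_space b)"
    using measurable_sets[OF measurable_scramble sets, of b x] by (simp add: vimage_def)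
  have reg: "AE \<pi> in perm_space b. regular_scrambling b \<pi> x" by (rule AE_regular_scrambling[OF assms])
  show "emeasure (distr (perm_space b) borel (\<lambda>\<pi>. scramble b \<pi> x)) (grid_cube b K c) =
      emeasure unif (grid_cube b K c)"
  proof (cases "\<forall>j. 0 \<le> c j \<and> c j < int (b ^ K)")
    case True
    then have c: "\<forall>j. nat (c j) < b ^ K" by (simp add: nat_less_iff)
    then have "\<forall>j. \<exists>e. (\<forall>k. e k < b) \<and> digit_value b e K = nat (c j)"
      using ex_digit_value_eq[OF assms] by blast
    then obtain e where e: "\<And>j k. e j k < b" "\<And>j. digit_value b (e j) K = nat (c j)" by metis
    let ?F = "(UNIV :: 'd set) \<times> {..<K}"
    let ?C = "{\<pi>. \<forall>(j, l)\<in>?F. scrambled_digit b \<pi> j (x $ j) l = e j l}"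
    have C: "emeasure (perm_space b) ?C = ennreal (1 / real b ^ card ?F)"
      by (rule emeasure_scrambled_digits[OF assms _ e(1)]) simp
    have "emeasure (perm_space b) {\<pi>. scramble b \<pi> x \<in> grid_cube b K c} = emeasure (perm_space b) ?C"
    proof (rule emeasure_eq_AE)
      show "AE \<pi> in perm_space b. \<pi> \<in> {\<pi>. scramble b \<pi> x \<in> grid_cube b K c} \<longleftrightarrow> \<pi> \<in> ?C"
        using reg
      proof eventually_elim
        case (elim \<pi>)
        have "\<lfloor>scramble b \<pi> x $ j * real b ^ K\<rfloor> = c j \<longleftrightarrow> (\<forall>l<K. scrambled_digit b \<pi> j (x $ j) l = e j l)" for j
        proof -
          have "\<lfloor>scramble b \<pi> x $ j * real b ^ K\<rfloor> = c j \<longleftrightarrow>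
              digit_value b (scrambled_digit b \<pi> j (x $ j)) K = digit_value b (e j) K"
            unfolding floor_scramble[OF assms elim] e(2) using True[rule_format, of j] by auto
          also have "\<dots> \<longleftrightarrow> (\<forall>l<K. scrambled_digit b \<pi> j (x $ j) l = e j l)"
            using elim by (intro digit_value_eq_iff assms scrambled_digit_less e(1))
              (auto simp: regular_scrambling_def)
          finally show ?thesis .
        qed
        then show ?case by (auto simp: grid_cube_def)
      qed
      show "?C \<in> sets (perm_space b)"
        using C assms by (intro emeasure_neq_0_sets) (auto simp: ennreal_eq_0_iff divide_le_0_iff not_le)
    qed (rule meas)
    also have "\<dots> = emeasure unif (grid_cube b K c)"
    proof -
      have "grid_cube b K c = elem_interval b (\<lambda>_. K) (\<lambda>j. nat (c j))"
        using True by (auto simp: grid_cube_def mem_elem_interval_iff[OF assms])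
      moreover have "emeasure unif (elem_interval b (\<lambda>_. K) (\<lambda>j. nat (c j))) =
          emeasure lborel (elem_interval b (\<lambda>_::'d. K) (\<lambda>j. nat (c j)))"
        by (intro emeasure_unif elem_interval_subset_unit_cube elem_interval_sets assms) (use c in auto)
      ultimately show ?thesis
        unfolding C by (simp add: emeasure_lborel_elem_interval[OF assms] card_cartesian_product)
    qed
    finally show ?thesis unfolding N .
  next
    case False
    have disj: "unit_cube \<inter> grid_cube b K c = {}"
    proof safe
      fix z assume z: "z \<in> unit_cube" "z \<in> grid_cube b K c"
      have "0 \<le> c j \<and> c j < int (b ^ K)" for j
      proof -
        have "0 \<le> z $ j" "z $ j < 1" and c: "c j = \<lfloor>z $ j * real b ^ K\<rfloor>"
          using z by (auto simp: unit_cube_def grid_cube_def)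
        then have "0 \<le> c j" "nat (c j) < b ^ K"
          using floor_mult_power_less[OF assms, of "z $ j" K] unfolding c by auto
        then show ?thesis by linarith
      qed
      with False show "z \<in> {}" by blast
    qed
    have "AE \<pi> in perm_space b. \<pi> \<notin> {\<pi>. scramble b \<pi> x \<in> grid_cube b K c}"
      using reg by eventually_elim (use scramble_mem_unit_cube[OF assms] disj in auto)
    then have "emeasure (perm_space b) {\<pi>. scramble b \<pi> x \<in> grid_cube b K c} = 0"
      using meas by (simp add: AE_iff_measurable[OF meas])
    then show ?thesis unfolding N using disj sets by simp
  qed
qed auto

lemma AE_scramble_unif:
  assumes "2 \<le> b" "AE u in unif. Q u" "{u. Q u} \<in> sets borel"
  shows "AE \<pi> in perm_space b. Q (scramble b \<pi> x)"
proof -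
  have "AE u in distr (perm_space b) borel (\<lambda>\<pi>. scramble b \<pi> x). Q u"
    unfolding distr_scramble[OF assms(1)] by fact
  then show ?thesis using assms(3) by (subst (asm) AE_distr_iff) auto
qed

lemma integral_scramble:
  fixes h :: "real^'d \<Rightarrow> real"
  assumes "2 \<le> b" "h \<in> borel_measurable borel"
  shows "(\<integral>\<pi>. h (scramble b \<pi> x) \<partial>perm_space b) = (\<integral>u. h u \<partial>unif)"
  unfolding distr_scramble[OF assms(1), symmetric, of x] using assms(2) by (subst integral_distr) auto

section \<open>Redrawing some coordinates of a product measure\<close>

lemma measurable_merge_PiM:
  fixes M :: "'i \<Rightarrow> 'a measure"
  shows "(\<lambda>(x, y) i. if i \<in> J then y i else x i) \<in> measurable (PiM UNIV M \<Otimes>\<^sub>M PiM UNIV M) (PiM UNIV M)"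
    (is "?m \<in> _")
proof (rule measurable_PiM_single')
  fix i
  have "(\<lambda>\<omega>. fst \<omega> i) \<in> measurable (PiM UNIV M \<Otimes>\<^sub>M PiM UNIV M) (M i)"
    "(\<lambda>\<omega>. snd \<omega> i) \<in> measurable (PiM UNIV M \<Otimes>\<^sub>M PiM UNIV M) (M i)"
    by (auto intro: measurable_compose[OF measurable_fst] measurable_compose[OF measurable_snd]
      measurable_component_singleton)
  then show "(\<lambda>\<omega>. ?m \<omega> i) \<in> measurable (PiM UNIV M \<Otimes>\<^sub>M PiM UNIV M) (M i)"
    by (cases "i \<in> J") (auto simp: case_prod_beta)
qed (auto simp: space_pair_measure space_PiM PiE_iff)

text \<open>For a cylinder over \<open>F\<close>, the first family answers for \<open>F - J\<close>
  and the second for \<open>F \<inter> J\<close>. Independence multiplies the two probabilities back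
  to the original product.\<close>

lemma distr_merge_PiM:
  fixes M :: "'i \<Rightarrow> 'a measure"
  assumes "product_prob_space M"
  shows "distr (PiM UNIV M \<Otimes>\<^sub>M PiM UNIV M) (PiM UNIV M) (\<lambda>(x, y) i. if i \<in> J then y i else x i) = PiM UNIV M"
proof -
  interpret product_prob_space M UNIV by fact
  interpret PP: pair_prob_space "PiM UNIV M" "PiM UNIV M" ..
  let ?m = "\<lambda>(x::'i \<Rightarrow> 'a, y) i. if i \<in> J then y i else x i"
  note m = measurable_merge_PiM[of J M]
  show ?thesis
  proof (rule PiM_eq)
    fix F X assume F: "finite F" "\<And>i. i \<in> F \<Longrightarrow> X i \<in> sets (M i)"
    let ?S = "\<lambda>G. {x \<in> space (PiM UNIV M). \<forall>i\<in>G. x i \<in> X i}"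
    have S: "?S G \<in> sets (PiM UNIV M)" if "G \<subseteq> F" for G
      using that F finite_subset[OF that F(1)]
      by (intro sets.sets_Collect_finite_All) (auto intro!: sets_Collect_single')
    have emb: "prod_emb UNIV M F (PiE F X) = ?S F"
      using F unfolding prod_emb_def by (auto simp: space_PiM Pi_iff)
    have "?m -` ?S F \<inter> space (PiM UNIV M \<Otimes>\<^sub>M PiM UNIV M) = ?S (F - J) \<times> ?S (F \<inter> J)"
      by (auto simp: space_pair_measure space_PiM PiE_iff split: if_splits)
    then have "emeasure (distr (PiM UNIV M \<Otimes>\<^sub>M PiM UNIV M) (PiM UNIV M) ?m) (prod_emb UNIV M F (PiE F X)) =
        emeasure (PiM UNIV M) (?S (F - J)) * emeasure (PiM UNIV M) (?S (F \<inter> J))"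
      unfolding emb using S[of F] S[of "F - J"] S[of "F \<inter> J"]
      by (subst emeasure_distr[OF m]) (simp_all add: P.emeasure_pair_measure_Times)
    also have "\<dots> = (\<Prod>i\<in>F - J. emeasure (M i) (X i)) * (\<Prod>i\<in>F \<inter> J. emeasure (M i) (X i))"
      using F by (subst (1 2) emeasure_PiM_Collect) auto
    also have "\<dots> = (\<Prod>i\<in>F. emeasure (M i) (X i))"
      using F(1) by (subst prod.union_disjoint[symmetric]) (auto intro!: prod.cong)
    finally show "emeasure (distr (PiM UNIV M \<Otimes>\<^sub>M PiM UNIV M) (PiM UNIV M) ?m) (prod_emb UNIV M F (PiE F X)) =
        (\<Prod>i\<in>F. emeasure (M i) (X i))" .
  qed simp
qed

section \<open>Pairs of scrambled points\<close>

text \<open>Fubini for the redrawn family; the bound \<open>B\<close> supplies integrability on the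
  product space.\<close>

lemma integral_perm_space_merge:
  fixes \<Phi> :: "('d::finite \<times> nat list \<Rightarrow> nat \<Rightarrow> nat) \<Rightarrow> real"
  assumes "\<Phi> \<in> borel_measurable (perm_space b)" "\<And>\<pi>. \<bar>\<Phi> \<pi>\<bar> \<le> B"
  shows "(\<integral>\<pi>. \<Phi> \<pi> \<partial>perm_space b) =
    (\<integral>\<pi>. (\<integral>\<pi>'. \<Phi> (\<lambda>i. if i \<in> J then \<pi>' i else \<pi> i) \<partial>perm_space b) \<partial>perm_space b)"
    and "(\<lambda>\<pi>. \<integral>\<pi>'. \<Phi> (\<lambda>i. if i \<in> J then \<pi>' i else \<pi> i) \<partial>perm_space b) \<in> borel_measurable (perm_space b)"
proof -
  let ?P = "perm_space b :: ('d \<times> nat list \<Rightarrow> nat \<Rightarrow> nat) measure"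
  interpret prob_space ?P by (rule prob_space_perm_space)
  interpret PP: pair_prob_space ?P ?P ..
  let ?m = "\<lambda>(\<pi>, \<pi>') i. if i \<in> J then \<pi>' i else (\<pi> :: 'd \<times> nat list \<Rightarrow> nat \<Rightarrow> nat) i"
  have d: "distr (?P \<Otimes>\<^sub>M ?P) ?P ?m = ?P"
    unfolding perm_space_def by (rule distr_merge_PiM[OF product_prob_space_perm])
  have m: "?m \<in> measurable (?P \<Otimes>\<^sub>M ?P) ?P"
    unfolding perm_space_def by (rule measurable_merge_PiM)
  have \<Phi>m: "(\<lambda>p. \<Phi> (?m p)) \<in> borel_measurable (?P \<Otimes>\<^sub>M ?P)"
    by (rule measurable_compose[OF m assms(1)])
  have "(\<integral>\<pi>. \<Phi> \<pi> \<partial>?P) = (\<integral>p. \<Phi> (?m p) \<partial>(?P \<Otimes>\<^sub>M ?P))"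
    by (subst d[symmetric], subst integral_distr[OF m assms(1)]) simp
  also have "\<dots> = (\<integral>\<pi>. (\<integral>\<pi>'. \<Phi> (?m (\<pi>, \<pi>')) \<partial>?P) \<partial>?P)"
    by (rule PP.integral_fst'[symmetric], rule PP.P.integrable_const_bound[of _ B])
      (use assms(2) \<Phi>m in auto)
  finally show "(\<integral>\<pi>. \<Phi> \<pi> \<partial>?P) = (\<integral>\<pi>. (\<integral>\<pi>'. \<Phi> (\<lambda>i. if i \<in> J then \<pi>' i else \<pi> i) \<partial>?P) \<partial>?P)"
    by simp
  show "(\<lambda>\<pi>. \<integral>\<pi>'. \<Phi> (\<lambda>i. if i \<in> J then \<pi>' i else \<pi> i) \<partial>?P) \<in> borel_measurable ?P"
    using \<Phi>m by (intro borel_measurable_lebesgue_integral) (simp add: case_prod_beta')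
qed

text \<open>The permutations that act on the digits of \<open>x\<close> beyond the shape \<open>\<kappa>\<close> are independent of
  all of the others, in particular of those that scramble \<open>y\<close>. Redrawing only these
  spreads the scrambled \<open>x\<close> uniformly over one elementary interval of shape \<open>\<kappa>\<close>, on which \<open>h\<close> has
  mean zero.\<close>

lemma integral_scramble_pair_eq_0:
  fixes x y :: "real^'d" and h :: "real^'d \<Rightarrow> real"
  assumes b: "2 \<le> b" and x: "x \<in> unit_cube" and y: "y \<in> unit_cube"
    and sep: "\<And>j. \<lfloor>x $ j * real b ^ \<kappa> j\<rfloor> \<noteq> \<lfloor>y $ j * real b ^ \<kappa> j\<rfloor>"
    and h: "h \<in> borel_measurable borel" "\<And>u. \<bar>h u\<bar> \<le> B"
    and orth: "\<And>c. (\<And>j. c j < b ^ \<kappa> j) \<Longrightarrow> (\<integral>u. h u * indicator (elem_interval b \<kappa> c) u \<partial>unif) = 0"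
  shows "(\<integral>\<pi>. h (scramble b \<pi> x) * h (scramble b \<pi> y) \<partial>perm_space b) = 0"
proof -
  let ?P = "perm_space b :: ('d \<times> nat list \<Rightarrow> nat \<Rightarrow> nat) measure"
  interpret prob_space ?P by (rule prob_space_perm_space)
  note [measurable] = h(1)
  have B: "0 \<le> B" using h(2)[of 0] by simp
  have xy: "0 \<le> x $ j" "x $ j < 1" "0 \<le> y $ j" "y $ j < 1" for j
    using x y by (auto simp: unit_cube_def)
  \<comment> \<open>These are the prefixes that extend the first \<open>\<kappa> j\<close> digits of
    \<open>x\<close>. A shorter prefix fails because \<open>take\<close> leaves it too
    short.\<close>
  define J where "J = {(j, p). take (\<kappa> j) p = digit_prefix b (x $ j) (\<kappa> j)}"
  define mg where "mg \<pi> \<pi>' = (\<lambda>i. if i \<in> J then \<pi>' i else \<pi> i)"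
    for \<pi> \<pi>' :: "'d \<times> nat list \<Rightarrow> nat \<Rightarrow> nat"
  have Jx: "(j, digit_prefix b (x $ j) l) \<in> J \<longleftrightarrow> \<kappa> j \<le> l" for j l
  proof
    assume "(j, digit_prefix b (x $ j) l) \<in> J"
    then have "length (take (\<kappa> j) (digit_prefix b (x $ j) l)) = length (digit_prefix b (x $ j) (\<kappa> j))"
      by (simp add: J_def)
    then show "\<kappa> j \<le> l" by simp
  qed (simp add: J_def take_digit_prefix)
  have Jy: "(j, digit_prefix b (y $ j) l) \<notin> J" for j l
  proof
    \<comment> \<open>A prefix of \<open>y\<close> in \<open>J\<close> would share its first
      \<open>\<kappa> j\<close> digits with \<open>x\<close>, against \<open>sep\<close>. Hence
      redrawing on \<open>J\<close> never touches the scrambled \<open>y\<close>.\<close>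
    assume J: "(j, digit_prefix b (y $ j) l) \<in> J"
    then have "length (take (\<kappa> j) (digit_prefix b (y $ j) l)) = length (digit_prefix b (x $ j) (\<kappa> j))"
      by (simp add: J_def)
    then have "\<kappa> j \<le> l" by simp
    with J have "digit_prefix b (y $ j) (\<kappa> j) = digit_prefix b (x $ j) (\<kappa> j)"
      by (simp add: J_def take_digit_prefix)
    with sep[of j] show False by (simp add: digit_prefix_eq_iff[OF b] xy)
  qed
  have sx: "scrambled_digit b (mg \<pi> \<pi>') j (x $ j) l =
      (if \<kappa> j \<le> l then scrambled_digit b \<pi>' j (x $ j) l else scrambled_digit b \<pi> j (x $ j) l)" for \<pi> \<pi>' j l
    by (simp add: scrambled_digit_def mg_def Jx)
  have scr_y: "scramble b (mg \<pi> \<pi>') y = scramble b \<pi> y" for \<pi> \<pi>'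
    by (simp add: vec_eq_iff scramble_nth scrambled_digit_def mg_def Jy)
  \<comment> \<open>\<open>R \<pi>\<close> is the conditional mean of \<open>h\<close> at the
    scrambled \<open>x\<close>, given the permutations outside \<open>J\<close>.\<close>
  define R where "R \<pi> = (\<integral>\<pi>'. h (scramble b (mg \<pi> \<pi>') x) \<partial>?P)" for \<pi>
  have R0: "R \<pi> = 0" if perm: "\<forall>i. \<pi> i permutes {..<b}" for \<pi>
  proof -
    define F where "F = (SIGMA j:UNIV. {..<\<kappa> j})"
    \<comment> \<open>\<open>C\<close> is the event that \<open>x\<close> receives the same leading
      digits as under \<open>\<pi>\<close>. On it \<open>R\<close> is constant, so integrating
      \<open>R\<close> over \<open>C\<close> gives \<open>R \<pi>\<close> times a positive
      probability; the same integral is then shown to be 0.\<close>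
    define C where "C = {\<rho>. \<forall>(j, l)\<in>F. scrambled_digit b \<rho> j (x $ j) l = scrambled_digit b \<pi> j (x $ j) l}"
    have less: "scrambled_digit b \<pi> j (x $ j) l < b" for j l
      by (rule scrambled_digit_less[OF b perm])
    have C: "emeasure ?P C = ennreal (1 / real b ^ card F)"
      unfolding C_def by (rule emeasure_scrambled_digits[OF b _ less]) (simp add: F_def)
    have C_pos: "0 < 1 / real b ^ card F" using b by simp
    have C_sets [measurable]: "C \<in> sets ?P"
      using C C_pos by (intro emeasure_neq_0_sets) (simp only: ennreal_eq_0_iff not_le simp_thms)
    have C_mg: "mg \<rho> \<rho>' \<in> C \<longleftrightarrow> \<rho> \<in> C" for \<rho> \<rho>'
      unfolding C_def F_def by (auto simp: sx)
    have "scramble b (mg \<rho> \<pi>') x = scramble b (mg \<pi> \<pi>') x" if "\<rho> \<in> C" for \<rho> \<pi>'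
      using that by (auto simp: vec_eq_iff scramble_nth sx C_def F_def intro!: suminf_cong)
    then have "R \<rho> * indicator C \<rho> = R \<pi> * indicator C \<rho>" for \<rho>
      by (simp add: R_def indicator_def)
    then have "(\<integral>\<rho>. R \<rho> * indicator C \<rho> \<partial>?P) = (\<integral>\<rho>. R \<pi> * indicator C \<rho> \<partial>?P)"
      by (simp only:)
    also have "\<dots> = R \<pi> * measure ?P C" by simp
    also have "measure ?P C = 1 / real b ^ card F" using C C_pos by (simp add: measure_def)
    finally have "(\<integral>\<rho>. R \<rho> * indicator C \<rho> \<partial>?P) = R \<pi> * (1 / real b ^ card F)" .
    \<comment> \<open>Membership in \<open>C\<close> ignores the permutations in \<open>J\<close>,
      so the indicator may be moved inside the inner integral and the redraw undone.\<close>
    moreover have "(\<integral>\<rho>. R \<rho> * indicator C \<rho> \<partial>?P) = (\<integral>\<rho>. h (scramble b \<rho> x) * indicator C \<rho> \<partial>?P)"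
    proof -
      have "(\<integral>\<rho>. h (scramble b \<rho> x) * indicator C \<rho> \<partial>?P) =
          (\<integral>\<rho>. (\<integral>\<rho>'. h (scramble b (mg \<rho> \<rho>') x) * indicator C (mg \<rho> \<rho>') \<partial>?P) \<partial>?P)"
        unfolding mg_def by (rule integral_perm_space_merge(1)[where B=B])
          (use h B in \<open>auto simp: indicator_def abs_mult\<close>)
      also have "\<dots> = (\<integral>\<rho>. R \<rho> * indicator C \<rho> \<partial>?P)"
        by (simp add: C_mg R_def indicator_def)
      finally show ?thesis ..
    qed
    moreover have "(\<integral>\<rho>. h (scramble b \<rho> x) * indicator C \<rho> \<partial>?P) = 0"
    proof -
      \<comment> \<open>On \<open>C\<close> the scrambled \<open>x\<close> lies in the elementary
        interval with this index, up to a null set.\<close>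
      define c where "c j = digit_value b (scrambled_digit b \<pi> j (x $ j)) (\<kappa> j)" for j
      have "AE \<rho> in ?P. h (scramble b \<rho> x) * indicator C \<rho> =
          h (scramble b \<rho> x) * indicator (elem_interval b \<kappa> c) (scramble b \<rho> x)"
        using AE_regular_scrambling[OF b, of x]
      proof eventually_elim
        case (elim \<rho>)
        then have "\<forall>i. \<rho> i permutes {..<b}" by (simp add: regular_scrambling_def)
        note less' = scrambled_digit_less[OF b this]
        have "\<rho> \<in> C \<longleftrightarrow> scramble b \<rho> x \<in> elem_interval b \<kappa> c"
          unfolding mem_elem_interval_iff[OF b] floor_scramble[OF b elim] c_def of_nat_eq_iff
            digit_value_eq_iff[OF b less' less] by (auto simp: C_def F_def)
        then show ?case by (simp add: indicator_def)
      qed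
      then have "(\<integral>\<rho>. h (scramble b \<rho> x) * indicator C \<rho> \<partial>?P) =
          (\<integral>\<rho>. h (scramble b \<rho> x) * indicator (elem_interval b \<kappa> c) (scramble b \<rho> x) \<partial>?P)"
        using elem_interval_sets[OF b, of \<kappa> c] by (intro integral_cong_AE) auto
      also have "\<dots> = (\<integral>u. h u * indicator (elem_interval b \<kappa> c) u \<partial>unif)"
        using elem_interval_sets[OF b, of \<kappa> c] by (intro integral_scramble[OF b]) auto
      also have "\<dots> = 0"
        by (rule orth) (simp add: c_def digit_value_less[OF b less])
      finally show ?thesis .
    qed
    ultimately show "R \<pi> = 0" using b by simp
  qed
  \<comment> \<open>The factor at \<open>y\<close> is unaffected by the redraw, so the inner
    integral is \<open>R \<pi>\<close> times it. \<open>R\<close> vanishes at families of genuine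
    permutations, which is almost everywhere.\<close>
  have "(\<integral>\<pi>. h (scramble b \<pi> x) * h (scramble b \<pi> y) \<partial>?P) =
      (\<integral>\<pi>. (\<integral>\<pi>'. h (scramble b (mg \<pi> \<pi>') x) * h (scramble b (mg \<pi> \<pi>') y) \<partial>?P) \<partial>?P)"
    unfolding mg_def by (rule integral_perm_space_merge(1)[where B="B * B"])
      (use h B in \<open>auto simp: abs_mult intro!: mult_mono\<close>)
  also have "\<dots> = (\<integral>\<pi>. R \<pi> * h (scramble b \<pi> y) \<partial>?P)"
    by (simp add: scr_y R_def)
  also have "\<dots> = (\<integral>\<pi>. 0 \<partial>?P)"
  proof (rule integral_cong_AE)
    show "(\<lambda>\<pi>. R \<pi> * h (scramble b \<pi> y)) \<in> borel_measurable ?P"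
      unfolding R_def mg_def using h
      by (intro borel_measurable_times integral_perm_space_merge(2)[where B=B]) auto
    show "AE \<pi> in ?P. R \<pi> * h (scramble b \<pi> y) = 0"
      using AE_perm_space_permutes by eventually_elim (simp add: R0)
  qed simp
  finally show ?thesis by simp
qed

text \<open>A Gram-Schmidt induction on \<open>S\<close>: take the residuals of \<open>f\<close> and
  of the new \<open>e s\<close> against the old functions, then remove from the first its component
  along the second.\<close>

lemma ex_orthogonal_projection:
  fixes f :: "'a \<Rightarrow> real" and e :: "'i \<Rightarrow> 'a \<Rightarrow> real"
  assumes "prob_space M" "finite S"
    and "f \<in> borel_measurable M" "\<exists>B. \<forall>x. \<bar>f x\<bar> \<le> B"
    and "\<And>s. s \<in> S \<Longrightarrow> e s \<in> borel_measurable M" "\<And>s. s \<in> S \<Longrightarrow> \<exists>B. \<forall>x. \<bar>e s x\<bar> \<le> B"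
  shows "\<exists>q. \<forall>s\<in>S. (\<integral>x. (f x - (\<Sum>r\<in>S. q r * e r x)) * e s x \<partial>M) = 0"
proof -
  interpret prob_space M by fact
  define bd where "bd g \<longleftrightarrow> g \<in> borel_measurable M \<and> (\<exists>B. \<forall>x. \<bar>g x\<bar> \<le> B)" for g :: "'a \<Rightarrow> real"
  have bd_int: "integrable M g" if "bd g" for g
    using that integrable_const_bound[of g] by (auto simp: bd_def)
  have bd_mult: "bd (\<lambda>x. g x * k x)" if "bd g" "bd k" for g k
  proof -
    from that obtain A B where AB: "\<forall>x. \<bar>g x\<bar> \<le> A" "\<forall>x. \<bar>k x\<bar> \<le> B" by (auto simp: bd_def)
    have "\<forall>x. \<bar>g x * k x\<bar> \<le> A * B"
    proof
      fix x
      have "\<bar>g x\<bar> * \<bar>k x\<bar> \<le> A * B"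
        using AB abs_ge_zero order_trans by (intro mult_mono) blast+
      then show "\<bar>g x * k x\<bar> \<le> A * B" by (simp add: abs_mult)
    qed
    with that show ?thesis by (auto simp: bd_def)
  qed
  have bd_cmult: "bd (\<lambda>x. a * g x)" if "bd g" for g a
  proof -
    have "bd (\<lambda>_. a)" unfolding bd_def by auto
    from bd_mult[OF this that] show ?thesis .
  qed
  have bd_diff: "bd (\<lambda>x. g x - k x)" if "bd g" "bd k" for g k
  proof -
    from that obtain A B where AB: "\<forall>x. \<bar>g x\<bar> \<le> A" "\<forall>x. \<bar>k x\<bar> \<le> B" by (auto simp: bd_def)
    have "\<forall>x. \<bar>g x - k x\<bar> \<le> A + B"
    proof
      fix x show "\<bar>g x - k x\<bar> \<le> A + B" using AB(1)[rule_format, of x] AB(2)[rule_format, of x] by linarith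
    qed
    with that show ?thesis by (auto simp: bd_def)
  qed
  have bd_sum: "bd (\<lambda>x. \<Sum>r\<in>T. q r * k r x)" if "finite T" "\<And>r. r \<in> T \<Longrightarrow> bd (k r)" for T q and k :: "'i \<Rightarrow> 'a \<Rightarrow> real"
    using that
  proof (induction T)
    case empty
    then show ?case by (auto simp: bd_def)
  next
    case (insert r T)
    \<comment> \<open>The sum is written as a difference so that the closure facts already at hand
      apply.\<close>
    have "bd (\<lambda>x. q r * k r x - (-1) * (\<Sum>r\<in>T. q r * k r x))"
      using insert by (intro bd_diff bd_cmult) auto
    then show ?case using insert by simp
  qed
  have "\<exists>q. \<forall>s\<in>S. (\<integral>x. (f x - (\<Sum>r\<in>S. q r * e r x)) * e s x \<partial>M) = 0"
    if "bd f" "\<And>s. s \<in> S \<Longrightarrow> bd (e s)" for f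
    using \<open>finite S\<close> that
  proof (induction S arbitrary: f)
    case (insert s S)
    from insert.IH[of f] insert.prems obtain q where
      q: "\<And>r. r \<in> S \<Longrightarrow> (\<integral>x. (f x - (\<Sum>r\<in>S. q r * e r x)) * e r x \<partial>M) = 0" by auto
    from insert.IH[of "e s"] insert.prems obtain p where
      p: "\<And>r. r \<in> S \<Longrightarrow> (\<integral>x. (e s x - (\<Sum>r\<in>S. p r * e r x)) * e r x \<partial>M) = 0" by auto
    define f1 where "f1 x = f x - (\<Sum>r\<in>S. q r * e r x)" for x
    define e1 where "e1 x = e s x - (\<Sum>r\<in>S. p r * e r x)" for x
    have f1: "bd f1" unfolding f1_def by (intro bd_diff bd_sum insert) auto
    have e1: "bd e1" unfolding e1_def by (intro bd_diff bd_sum insert) auto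
    have er: "\<And>r. r \<in> S \<Longrightarrow> bd (e r)" using insert by auto
    \<comment> \<open>If \<open>e1\<close> has norm zero, division by zero makes \<open>a\<close>
      equal to 0. Then \<open>e1\<close> vanishes almost everywhere and the equation for
      \<open>a\<close> still holds, which covers linearly dependent functions.\<close>
    define a where "a = (\<integral>x. f1 x * e1 x \<partial>M) / (\<integral>x. e1 x * e1 x \<partial>M)"
    have a: "(\<integral>x. f1 x * e1 x \<partial>M) = a * (\<integral>x. e1 x * e1 x \<partial>M)"
    proof (cases "(\<integral>x. e1 x * e1 x \<partial>M) = 0")
      case True
      then have "AE x in M. e1 x * e1 x = 0"
        by (subst (asm) integral_nonneg_eq_0_iff_AE) (auto intro: bd_int bd_mult e1)
      then have "(\<integral>x. f1 x * e1 x \<partial>M) = (\<integral>x. 0 \<partial>M)"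
        using bd_mult[OF f1 e1] by (intro integral_cong_AE) (auto simp: bd_def)
      with True show ?thesis by simp
    qed (simp add: a_def)
    have orth: "(\<integral>x. (f1 x - a * e1 x) * e r x \<partial>M) = 0" if "r \<in> S" for r
    proof -
      have "(\<integral>x. (f1 x - a * e1 x) * e r x \<partial>M) = (\<integral>x. f1 x * e r x \<partial>M) - a * (\<integral>x. e1 x * e r x \<partial>M)"
        using bd_int[OF bd_mult[OF f1 er[OF that]]] bd_int[OF bd_mult[OF e1 er[OF that]]]
        by (simp add: left_diff_distrib mult.assoc)
      with q[OF that] p[OF that] show ?thesis by (simp add: f1_def e1_def)
    qed
    have orth_e1: "(\<integral>x. (f1 x - a * e1 x) * e1 x \<partial>M) = 0"
      using bd_int[OF bd_mult[OF f1 e1]] bd_int[OF bd_mult[OF e1 e1]] a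
      by (simp add: left_diff_distrib mult.assoc)
    define h where "h x = f1 x - a * e1 x" for x
    have h: "bd h" unfolding h_def by (intro bd_diff bd_cmult f1 e1)
    have "(\<integral>x. h x * e s x \<partial>M) = (\<integral>x. h x * e1 x + (\<Sum>r\<in>S. p r * (h x * e r x)) \<partial>M)"
      by (intro Bochner_Integration.integral_cong refl) (simp add: e1_def algebra_simps sum_distrib_left)
    also have "\<dots> = (\<integral>x. h x * e1 x \<partial>M) + (\<Sum>r\<in>S. p r * (\<integral>x. h x * e r x \<partial>M))"
      using bd_int[OF bd_mult[OF h e1]] bd_int[OF bd_mult[OF h er]]
      by (subst Bochner_Integration.integral_add) (auto simp: Bochner_Integration.integral_sum)
    also have "\<dots> = 0" using orth orth_e1 by (simp add: h_def)
    finally have "(\<integral>x. h x * e s x \<partial>M) = 0" .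
    with orth have "\<forall>r\<in>insert s S. (\<integral>x. h x * e r x \<partial>M) = 0" by (simp add: h_def)
    \<comment> \<open>Expanding both residuals in \<open>f1 - a * e1\<close> gives the coefficient
      \<open>a\<close> at \<open>s\<close> and \<open>q r - a * p r\<close> at each old
      \<open>r\<close>.\<close>
    moreover have "h x = f x - (\<Sum>r\<in>insert s S. ((\<lambda>r. q r - a * p r)(s := a)) r * e r x)" for x
    proof -
      have "(\<Sum>r\<in>S. ((\<lambda>r. q r - a * p r)(s := a)) r * e r x) = (\<Sum>r\<in>S. (q r - a * p r) * e r x)"
        using insert.hyps by (intro sum.cong) auto
      then show ?thesis using insert.hyps
        by (simp add: h_def f1_def e1_def left_diff_distrib sum_subtractf sum_distrib_left algebra_simps)
    qed
    ultimately show ?case by (intro exI[of _ "(\<lambda>r. q r - a * p r)(s := a)"]) simp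
  qed simp
  with assms show ?thesis by (simp add: bd_def)
qed

section \<open>Points of a net that share long digit prefixes\<close>

lemma ex_sum_eq_below:
  fixes e :: "'d::finite \<Rightarrow> nat"
  assumes "M \<le> (\<Sum>j\<in>UNIV. e j)"
  shows "\<exists>\<kappa>. (\<forall>j. \<kappa> j \<le> e j) \<and> (\<Sum>j\<in>UNIV. \<kappa> j) = M"
  using assms
proof (induction rule: inc_induct)
  case (step n)
  then obtain \<kappa> where \<kappa>: "\<forall>j. \<kappa> j \<le> e j" "(\<Sum>j\<in>UNIV. \<kappa> j) = Suc n" by blast
  then obtain j where j: "\<kappa> j > 0" by (metis sum.neutral bot_nat_0.not_eq_extremum nat.distinct(1))
  let ?\<kappa> = "\<kappa>(j := \<kappa> j - 1)"
  have "(\<Sum>l\<in>UNIV. ?\<kappa> l) = \<kappa> j - 1 + (\<Sum>l\<in>UNIV - {j}. \<kappa> l)"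
    by (subst sum.remove[of _ j]) auto
  also have "\<dots> = n" using \<kappa>(2) j by (simp add: sum.remove[of _ j])
  finally show ?case using \<kappa>(1) by (intro exI[of _ ?\<kappa>]) (auto simp: le_diff_conv intro: le_SucI)
qed blast

lemma ex_sum_eq_above:
  fixes e :: "'d::finite \<Rightarrow> nat"
  assumes "(\<Sum>j\<in>UNIV. e j) \<le> M"
  shows "\<exists>\<kappa>. (\<forall>j. e j \<le> \<kappa> j) \<and> (\<Sum>j\<in>UNIV. \<kappa> j) = M"
proof -
  \<comment> \<open>Types are nonempty, so some coordinate \<open>j\<close> exists; it absorbs the
    whole deficit.\<close>
  fix j :: 'd
  let ?\<kappa> = "e(j := e j + (M - (\<Sum>j\<in>UNIV. e j)))"
  have "(\<Sum>l\<in>UNIV. ?\<kappa> l) = e j + (M - (\<Sum>j\<in>UNIV. e j)) + (\<Sum>l\<in>UNIV - {j}. e l)"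
    by (subst sum.remove[of _ j]) auto
  also have "\<dots> = M" using assms by (simp add: sum.remove[of _ j e])
  finally show ?thesis by (intro exI[of _ ?\<kappa>]) auto
qed

lemma PiE_UNIV_eq: "PiE UNIV A = {f. \<forall>x. f x \<in> A x}"
  by (auto simp: PiE_def)

lemma shapes_finite_card:
  "finite {\<kappa> :: 'd::finite \<Rightarrow> nat. (\<Sum>j\<in>UNIV. \<kappa> j) = M}"
  "card {\<kappa> :: 'd::finite \<Rightarrow> nat. (\<Sum>j\<in>UNIV. \<kappa> j) = M} \<le> (M + 1) ^ CARD('d)"
proof -
  let ?X = "PiE (UNIV :: 'd set) (\<lambda>_. {..M})"
  have sub: "{\<kappa> :: 'd \<Rightarrow> nat. (\<Sum>j\<in>UNIV. \<kappa> j) = M} \<subseteq> ?X"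
    unfolding PiE_UNIV_eq by (auto intro: member_le_sum)
  have fin: "finite ?X" by (intro finite_PiE) auto
  from sub fin show "finite {\<kappa> :: 'd \<Rightarrow> nat. (\<Sum>j\<in>UNIV. \<kappa> j) = M}" by (rule finite_subset)
  from card_mono[OF fin sub] show "card {\<kappa> :: 'd \<Rightarrow> nat. (\<Sum>j\<in>UNIV. \<kappa> j) = M} \<le> (M + 1) ^ CARD('d)"
    by (simp add: card_PiE)
qed

lemma card_UN_le_mult:
  assumes "finite I" "card I \<le> N" "\<And>i. i \<in> I \<Longrightarrow> card (A i) \<le> (C::nat)"
  shows "card (\<Union>i\<in>I. A i) \<le> N * C"
proof -
  have "card (\<Union>i\<in>I. A i) \<le> (\<Sum>i\<in>I. card (A i))" by (rule card_UN_le[OF assms(1)])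
  also have "\<dots> \<le> card I * C" using sum_bounded_above[of I "\<lambda>i. card (A i)" C] assms(3) by simp
  also have "\<dots> \<le> N * C" using assms(2) by simp
  finally show ?thesis .
qed

text \<open>A single shape has to separate the two points in every coordinate at once, as in the
  hypothesis of \<open>integral_scramble_pair_eq_0\<close>; lying in different elementary intervals
  is weaker.\<close>

definition separated :: "nat \<Rightarrow> nat \<Rightarrow> real^'d \<Rightarrow> real^'d \<Rightarrow> bool" where
  "separated b M x y \<longleftrightarrow> (\<exists>\<kappa>. (\<Sum>j\<in>UNIV. \<kappa> j) = M \<and>
     (\<forall>j. \<lfloor>x $ j * real b ^ \<kappa> j\<rfloor> \<noteq> \<lfloor>y $ j * real b ^ \<kappa> j\<rfloor>))"

text \<open>Let \<open>e j\<close> be the first level at which coordinate \<open>j\<close> tells the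
  points apart. If these levels summed to less than \<open>M\<close>, enlarging them to total
  \<open>M\<close> would separate the points. So a shape of total \<open>M\<close> fits below
  \<open>e\<close>, and one level before it the coordinates still agree.\<close>

lemma not_separated_imp_close:
  fixes x y :: "real^'d"
  assumes "2 \<le> b" "\<not> separated b M x y"
  obtains \<kappa> where "(\<Sum>j\<in>UNIV. \<kappa> j) = M"
    "\<And>j. \<kappa> j > 0 \<Longrightarrow> \<lfloor>x $ j * real b ^ (\<kappa> j - 1)\<rfloor> = \<lfloor>y $ j * real b ^ (\<kappa> j - 1)\<rfloor>"
proof -
  define D where "D j k \<longleftrightarrow> \<lfloor>x $ j * real b ^ k\<rfloor> \<noteq> \<lfloor>y $ j * real b ^ k\<rfloor>" for j k
  have D_mono: "D j k'" if "D j k" "k \<le> k'" for j k k'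
    using that floor_mult_power_div[OF assms(1) that(2)] unfolding D_def by auto
  \<comment> \<open>The cap at \<open>M\<close> keeps the minimum defined when two coordinates agree
    at every level. It is not reached when the sum stays below \<open>M\<close>.\<close>
  define e where "e j = (LEAST k. D j k \<or> M \<le> k)" for j
  have e: "D j (e j) \<or> M \<le> e j" for j
    unfolding e_def by (rule LeastI[of _ M]) simp
  have not_D: "\<not> D j k" if "k < e j" for j k
    using not_less_Least[of k "\<lambda>k. D j k \<or> M \<le> k"] that unfolding e_def by blast
  have "M \<le> (\<Sum>j\<in>UNIV. e j)"
  proof (rule ccontr)
    assume less: "\<not> M \<le> (\<Sum>j\<in>UNIV. e j)"
    have "e j < M" for j
      using less member_le_sum[of j UNIV e] by simp
    then have De: "D j (e j)" for j using e[of j] by (meson not_le)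
    obtain \<kappa> where \<kappa>: "\<forall>j. e j \<le> \<kappa> j" "(\<Sum>j\<in>UNIV. \<kappa> j) = M"
      using ex_sum_eq_above[of e M] less by auto
    then have "\<forall>j. D j (\<kappa> j)" using De D_mono by blast
    with \<kappa>(2) assms(2) show False by (auto simp: separated_def D_def)
  qed
  then obtain \<kappa> where \<kappa>: "\<forall>j. \<kappa> j \<le> e j" "(\<Sum>j\<in>UNIV. \<kappa> j) = M"
    using ex_sum_eq_below by blast
  show ?thesis
  proof (rule that[OF \<kappa>(2)])
    fix j assume "\<kappa> j > 0"
    then have "\<kappa> j - 1 < e j" using \<kappa>(1)[rule_format, of j] by linarith
    from not_D[OF this] show "\<lfloor>x $ j * real b ^ (\<kappa> j - 1)\<rfloor> = \<lfloor>y $ j * real b ^ (\<kappa> j - 1)\<rfloor>"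
      by (simp add: D_def)
  qed
qed

text \<open>For a suitable shape, such a partner shares with \<open>x i\<close> the parent cell in
  each coordinate. This leaves at most \<open>b\<close> cells per axis, and each resulting
  elementary interval holds \<open>b\<close> to the power \<open>t\<close> points; the number of
  shapes is polynomial in \<open>m\<close>.\<close>

lemma card_not_separated:
  fixes x :: "nat \<Rightarrow> real^'d"
  assumes b: "2 \<le> b" and net: "is_net b t m x" and i: "i < b ^ m"
  shows "card {i'\<in>{..<b ^ m}. \<not> separated b (m - t) (x i) (x i')} \<le>
    (m + 1) ^ CARD('d) * (b ^ CARD('d) * b ^ t)"
proof -
  have x: "0 \<le> x l $ j" "x l $ j < 1" if "l < b ^ m" for l j
    using net that by (auto simp: is_net_def)
  define c where "c \<kappa> j = nat \<lfloor>x i $ j * real b ^ \<kappa> j\<rfloor>" for \<kappa> j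
  \<comment> \<open>Per axis these are the \<open>b\<close> indices with the same quotient by
    \<open>b\<close>, that is, the children of one parent cell. For \<open>\<kappa> j = 0\<close>
    some indices fall out of range and are filtered out below.\<close>
  define Cs where "Cs \<kappa> = PiE UNIV (\<lambda>j. {b * (c \<kappa> j div b)..<b * (c \<kappa> j div b) + b})" for \<kappa>
  define Is where "Is \<kappa> c' = {l\<in>{..<b ^ m}. x l \<in> elem_interval b \<kappa> c'}" for \<kappa> c'
  have Cs: "finite (Cs \<kappa>)" "card (Cs \<kappa>) = b ^ CARD('d)" for \<kappa>
    unfolding Cs_def by (auto intro!: finite_PiE simp: card_PiE)
  have "{i'\<in>{..<b ^ m}. \<not> separated b (m - t) (x i) (x i')} \<subseteq>
      (\<Union>\<kappa>\<in>{\<kappa>. (\<Sum>j\<in>UNIV. \<kappa> j) = m - t}. \<Union>c'\<in>{c'\<in>Cs \<kappa>. \<forall>j. c' j < b ^ \<kappa> j}. Is \<kappa> c')"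
  proof
    fix l assume "l \<in> {i'\<in>{..<b ^ m}. \<not> separated b (m - t) (x i) (x i')}"
    then have l: "l < b ^ m" "\<not> separated b (m - t) (x i) (x l)" by auto
    obtain \<kappa> where \<kappa>: "(\<Sum>j\<in>UNIV. \<kappa> j) = m - t"
      "\<And>j. \<kappa> j > 0 \<Longrightarrow> \<lfloor>x i $ j * real b ^ (\<kappa> j - 1)\<rfloor> = \<lfloor>x l $ j * real b ^ (\<kappa> j - 1)\<rfloor>"
      using not_separated_imp_close[OF b l(2)] by blast
    define c' where "c' j = nat \<lfloor>x l $ j * real b ^ \<kappa> j\<rfloor>" for j
    have "c' j \<in> {b * (c \<kappa> j div b)..<b * (c \<kappa> j div b) + b}" for j
    proof (cases "\<kappa> j")
      case 0
      have "\<lfloor>x i $ j\<rfloor> = 0" "\<lfloor>x l $ j\<rfloor> = 0" using x[OF i, of j] x[OF l(1), of j] by (simp_all add: floor_eq_iff)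
      then show ?thesis using 0 b by (simp add: c_def c'_def)
    next
      case (Suc k)
      have nat_step: "nat \<lfloor>x a $ j * real b ^ Suc k\<rfloor> = b * nat \<lfloor>x a $ j * real b ^ k\<rfloor> + digit b (Suc k) (x a $ j)"
        if "a < b ^ m" for a
        unfolding floor_mult_power_Suc[OF b] using x[OF that, of j]
        by (simp add: nat_add_distrib nat_mult_distrib)
      have eq: "\<lfloor>x i $ j * real b ^ k\<rfloor> = \<lfloor>x l $ j * real b ^ k\<rfloor>" using \<kappa>(2)[of j] Suc by simp
      show ?thesis
        unfolding c_def c'_def Suc nat_step[OF i] nat_step[OF l(1)] eq
        using digit_less[OF b, of "Suc k" "x i $ j"] digit_less[OF b, of "Suc k" "x l $ j"] by simp
    qed
    then have "c' \<in> Cs \<kappa>" by (simp add: Cs_def PiE_UNIV_eq)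
    moreover have "\<forall>j. c' j < b ^ \<kappa> j"
      using floor_mult_power_less[OF b x[OF l(1)]] by (simp add: c'_def)
    moreover have "l \<in> Is \<kappa> c'"
      using l(1) x[OF l(1)] by (simp add: Is_def mem_elem_interval_iff[OF b] c'_def)
    ultimately show "l \<in> (\<Union>\<kappa>\<in>{\<kappa>. (\<Sum>j\<in>UNIV. \<kappa> j) = m - t}. \<Union>c'\<in>{c'\<in>Cs \<kappa>. \<forall>j. c' j < b ^ \<kappa> j}. Is \<kappa> c')"
      using \<kappa>(1) by blast
  qed
  then have "card {i'\<in>{..<b ^ m}. \<not> separated b (m - t) (x i) (x i')} \<le>
      card (\<Union>\<kappa>\<in>{\<kappa>. (\<Sum>j\<in>UNIV. \<kappa> j) = m - t}. \<Union>c'\<in>{c'\<in>Cs \<kappa>. \<forall>j. c' j < b ^ \<kappa> j}. Is \<kappa> c')"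
  proof (rule card_mono[rotated])
    have "(\<Union>\<kappa>\<in>{\<kappa>. (\<Sum>j\<in>UNIV. \<kappa> j) = m - t}. \<Union>c'\<in>{c'\<in>Cs \<kappa>. \<forall>j. c' j < b ^ \<kappa> j}. Is \<kappa> c') \<subseteq> {..<b ^ m}"
      by (auto simp: Is_def)
    then show "finite (\<Union>\<kappa>\<in>{\<kappa>. (\<Sum>j\<in>UNIV. \<kappa> j) = m - t}. \<Union>c'\<in>{c'\<in>Cs \<kappa>. \<forall>j. c' j < b ^ \<kappa> j}. Is \<kappa> c')"
      by (rule finite_subset) simp
  qed
  also have "\<dots> \<le> (m + 1) ^ CARD('d) * (b ^ CARD('d) * b ^ t)"
  proof (intro card_UN_le_mult)
    show "card {\<kappa> :: 'd \<Rightarrow> nat. (\<Sum>j\<in>UNIV. \<kappa> j) = m - t} \<le> (m + 1) ^ CARD('d)"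
      by (rule order_trans[OF shapes_finite_card(2)]) (simp add: power_mono)
    show "card {c'\<in>Cs \<kappa>. \<forall>j. c' j < b ^ \<kappa> j} \<le> b ^ CARD('d)" for \<kappa>
      unfolding Cs(2)[of \<kappa>, symmetric] by (intro card_mono Cs(1)) auto
    show "card (Is \<kappa> c') \<le> b ^ t" if "\<kappa> \<in> {\<kappa>. (\<Sum>j\<in>UNIV. \<kappa> j) = m - t}"
      "c' \<in> {c'\<in>Cs \<kappa>. \<forall>j. c' j < b ^ \<kappa> j}" for \<kappa> c'
      using net that by (simp add: is_net_def Is_def)
  qed (use Cs(1) shapes_finite_card(1) in auto)
  finally show ?thesis .
qed

section \<open>Second moments of scrambled net means\<close>

text \<open>The error of the mean comes from the residual \<open>h\<close> alone, as the net is
  exact on the projection. Of all pairs in the expanded square only those not separated contribute,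
  each at most 1, so the bound is the number of partners per point divided by the number of
  points.\<close>

lemma scrambled_net_second_moment:
  fixes x :: "nat \<Rightarrow> real^'d"
  assumes b: "2 \<le> b" and net: "is_net b t m x" and A [measurable]: "A \<in> sets borel"
  shows "(\<integral>\<pi>. ((\<Sum>i<b ^ m. indicator A (scramble b \<pi> (x i))) / real (b ^ m) - measure unif A)\<^sup>2 \<partial>perm_space b)
    \<le> real ((m + 1) ^ CARD('d) * (b ^ CARD('d) * b ^ t)) / real (b ^ m)"
proof -
  let ?P = "perm_space b :: ('d \<times> nat list \<Rightarrow> nat \<Rightarrow> nat) measure"
  interpret P: prob_space ?P by (rule prob_space_perm_space)
  interpret U: prob_space "unif :: (real^'d) measure" by (rule prob_space_unif)
  have tm: "t \<le> m" using net by (simp add: is_net_def)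
  have x: "x i \<in> unit_cube" if "i < b ^ m" for i
    using net that by (auto simp: is_net_def unit_cube_def)
  define cells :: "(('d \<Rightarrow> nat) \<times> ('d \<Rightarrow> nat)) set"
    where "cells = (SIGMA \<kappa>:{\<kappa>. (\<Sum>j\<in>UNIV. \<kappa> j) = m - t}. PiE UNIV (\<lambda>j. {..<b ^ \<kappa> j}))"
  \<comment> \<open>\<open>UNIV\<close> puts the constants into the span, so that \<open>h\<close>
    has mean zero under \<open>unif\<close>.\<close>
  define S where "S = insert UNIV ((\<lambda>(\<kappa>, c). elem_interval b \<kappa> c) ` cells)"
  have S_fin: "finite S"
    unfolding S_def cells_def using shapes_finite_card(1)
    by (intro finite.insertI finite_imageI finite_SigmaI finite_PiE) auto
  have S_sets: "s \<in> sets borel" if "s \<in> S" for s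
    using that elem_interval_sets[OF b] by (auto simp: S_def)
  obtain q where q: "\<forall>s\<in>S. (\<integral>u. (indicator A u - (\<Sum>r\<in>S. q r * indicator r u)) * indicator s u \<partial>unif) = (0::real)"
  proof -
    have "\<exists>q. \<forall>s\<in>S. (\<integral>u. (indicator A u - (\<Sum>r\<in>S. q r * indicator r u)) * indicator s u \<partial>unif) = (0::real)"
      by (rule ex_orthogonal_projection[OF prob_space_unif S_fin])
        (use S_sets A in \<open>auto intro!: exI[of _ 1] simp: indicator_def\<close>)
    then show ?thesis using that by blast
  qed
  define h :: "real^'d \<Rightarrow> real" where "h u = indicator A u - (\<Sum>r\<in>S. q r * indicator r u)" for u
  have h_meas [measurable]: "h \<in> borel_measurable borel"
    unfolding h_def using S_sets by (intro borel_measurable_diff borel_measurable_sum borel_measurable_times) auto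
  \<comment> \<open>A crude bound that serves integrability and does not enter the final
    estimate.\<close>
  define B where "B = 1 + (\<Sum>r\<in>S. \<bar>q r\<bar>)"
  have h_bound: "\<bar>h u\<bar> \<le> B" for u
  proof -
    have "\<bar>\<Sum>r\<in>S. q r * indicator r u\<bar> \<le> (\<Sum>r\<in>S. \<bar>q r\<bar>)"
      by (intro order_trans[OF sum_abs] sum_mono) (simp add: indicator_def)
    moreover have "\<bar>indicator A u :: real\<bar> \<le> 1" by (simp add: indicator_def)
    ultimately show ?thesis unfolding h_def B_def by linarith
  qed
  have orth: "(\<integral>u. h u * indicator s u \<partial>unif) = 0" if "s \<in> S" for s
    using q that by (simp add: h_def)
  have orth_cell: "(\<integral>u. h u * indicator (elem_interval b \<kappa> c) u \<partial>unif) = 0"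
    if "(\<Sum>j\<in>UNIV. \<kappa> j) = m - t" "\<And>j. c j < b ^ \<kappa> j" for \<kappa> c
    using that by (intro orth) (auto simp: S_def cells_def PiE_UNIV_eq intro!: image_eqI[of _ _ "(\<kappa>, c)"])
  have int_h: "integrable unif (\<lambda>u. h u * k u)" if "k \<in> borel_measurable borel" "\<And>u. \<bar>k u\<bar> \<le> D" for k D
  proof (rule U.integrable_const_bound[of _ "B * D"])
    show "AE u in unif. norm (h u * k u) \<le> B * D"
      using h_bound that(2) order_trans[OF abs_ge_zero h_bound] by (auto simp: abs_mult intro!: mult_mono)
    have [measurable]: "k \<in> borel_measurable borel" by fact
    show "(\<lambda>u. h u * k u) \<in> borel_measurable unif" by measurable
  qed
  have int_hs: "integrable unif (\<lambda>u. h u * indicator s u)" if "s \<in> sets borel" for s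
    using that by (intro int_h[of _ 1]) (auto simp: indicator_def)
  \<comment> \<open>By orthogonality of \<open>h\<close> to the projection, the square of
    \<open>h\<close> and \<open>h\<close> times the indicator of \<open>A\<close> have the same
    integral. Expanding the square of the projection, which is nonnegative, then bounds this
    integral by the measure of \<open>A\<close>.\<close>
  have h_sq: "(\<integral>u. h u * h u \<partial>unif) \<le> 1"
  proof -
    have "(\<integral>u. h u * h u \<partial>unif) = (\<integral>u. h u * indicator A u - (\<Sum>r\<in>S. q r * (h u * indicator r u)) \<partial>unif)"
      by (intro Bochner_Integration.integral_cong refl)
        (simp add: h_def right_diff_distrib sum_distrib_left mult.left_commute)
    also have "\<dots> = (\<integral>u. h u * indicator A u \<partial>unif) - (\<Sum>r\<in>S. q r * (\<integral>u. h u * indicator r u \<partial>unif))"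
      using int_hs S_sets A
      by (subst Bochner_Integration.integral_diff) (auto simp: Bochner_Integration.integral_sum)
    finally have hh: "(\<integral>u. h u * h u \<partial>unif) = (\<integral>u. h u * indicator A u \<partial>unif)" by (simp add: orth)
    have "0 \<le> (\<integral>u. (indicator A u - h u)\<^sup>2 \<partial>unif)" by (intro Bochner_Integration.integral_nonneg) simp
    also have "\<dots> = (\<integral>u. indicator A u - 2 * (h u * indicator A u) + h u * h u \<partial>unif)"
      by (intro Bochner_Integration.integral_cong refl) (auto simp: power2_eq_square algebra_simps indicator_def)
    also have "\<dots> = measure unif A - 2 * (\<integral>u. h u * indicator A u \<partial>unif) + (\<integral>u. h u * h u \<partial>unif)"
      using int_hs[OF A] int_h[OF h_meas h_bound] A by (simp add: U.emeasure_eq_measure)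
    finally have "(\<integral>u. h u * h u \<partial>unif) \<le> measure unif A" using hh by simp
    also have "\<dots> \<le> 1" by simp
    finally show ?thesis .
  qed

  let ?u = "\<lambda>\<pi> i. scramble b \<pi> (x i)"
  have int_hh: "integrable ?P (\<lambda>\<pi>. h (?u \<pi> i) * h (?u \<pi> k))" for i k
    by (rule P.integrable_const_bound[of _ "B * B"])
      (use h_bound order_trans[OF abs_ge_zero h_bound] in \<open>auto simp: abs_mult intro!: mult_mono\<close>)
  \<comment> \<open>A product is at most the mean of the two squares, and each scrambled point is
    uniform.\<close>
  have pair_le: "(\<integral>\<pi>. h (?u \<pi> i) * h (?u \<pi> k) \<partial>?P) \<le> 1" for i k
  proof -
    have "(\<integral>\<pi>. h (?u \<pi> i) * h (?u \<pi> k) \<partial>?P) \<le>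
        (\<integral>\<pi>. (h (?u \<pi> i) * h (?u \<pi> i) + h (?u \<pi> k) * h (?u \<pi> k)) / 2 \<partial>?P)"
    proof (intro integral_mono int_hh integrable_divide Bochner_Integration.integrable_add)
      fix \<pi>
      show "h (?u \<pi> i) * h (?u \<pi> k) \<le> (h (?u \<pi> i) * h (?u \<pi> i) + h (?u \<pi> k) * h (?u \<pi> k)) / 2"
        using sum_squares_bound[of "h (?u \<pi> i)" "h (?u \<pi> k)"] by (simp add: power2_eq_square)
    qed
    also have "\<dots> = ((\<integral>\<pi>. h (?u \<pi> i) * h (?u \<pi> i) \<partial>?P) + (\<integral>\<pi>. h (?u \<pi> k) * h (?u \<pi> k) \<partial>?P)) / 2"
      using int_hh by simp
    also have "\<dots> = (\<integral>u. h u * h u \<partial>unif)"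
      by (simp add: integral_scramble[OF b, of "\<lambda>u. h u * h u"])
    also have "\<dots> \<le> 1" by (rule h_sq)
    finally show ?thesis .
  qed
  have pair_0: "(\<integral>\<pi>. h (?u \<pi> i) * h (?u \<pi> k) \<partial>?P) = 0"
    if "i < b ^ m" "k < b ^ m" "separated b (m - t) (x i) (x k)" for i k
  proof -
    from that(3) obtain \<kappa> where "(\<Sum>j\<in>UNIV. \<kappa> j) = m - t"
      "\<And>j. \<lfloor>x i $ j * real b ^ \<kappa> j\<rfloor> \<noteq> \<lfloor>x k $ j * real b ^ \<kappa> j\<rfloor>" by (auto simp: separated_def)
    with that(1,2) show ?thesis
      by (intro integral_scramble_pair_eq_0[OF b x x, where B=B and \<kappa>=\<kappa>] h_meas h_bound orth_cell) auto
  qed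
  define C where "C = (m + 1) ^ CARD('d) * (b ^ CARD('d) * b ^ t)"
  have "(\<integral>\<pi>. (\<Sum>i<b ^ m. h (?u \<pi> i))\<^sup>2 \<partial>?P) = (\<integral>\<pi>. (\<Sum>i<b ^ m. \<Sum>k<b ^ m. h (?u \<pi> i) * h (?u \<pi> k)) \<partial>?P)"
    by (simp add: power2_eq_square sum_product)
  also have "\<dots> = (\<Sum>i<b ^ m. \<Sum>k<b ^ m. (\<integral>\<pi>. h (?u \<pi> i) * h (?u \<pi> k) \<partial>?P))"
    using int_hh by (simp add: Bochner_Integration.integral_sum)
  also have "\<dots> \<le> (\<Sum>i<b ^ m. real C)"
  proof (rule sum_mono)
    fix i assume i: "i \<in> {..<b ^ m}"
    let ?N = "{k\<in>{..<b ^ m}. \<not> separated b (m - t) (x i) (x k)}"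
    have "(\<Sum>k<b ^ m. (\<integral>\<pi>. h (?u \<pi> i) * h (?u \<pi> k) \<partial>?P)) = (\<Sum>k\<in>?N. (\<integral>\<pi>. h (?u \<pi> i) * h (?u \<pi> k) \<partial>?P))"
      using i by (intro sum.mono_neutral_right) (auto intro: pair_0)
    also have "\<dots> \<le> (\<Sum>k\<in>?N. 1)" by (intro sum_mono pair_le)
    also have "\<dots> = real (card ?N)" by simp
    also have "\<dots> \<le> real C"
      unfolding C_def of_nat_le_iff using card_not_separated[OF b net] i by blast
    finally show "(\<Sum>k<b ^ m. (\<integral>\<pi>. h (?u \<pi> i) * h (?u \<pi> k) \<partial>?P)) \<le> real C" .
  qed
  finally have moment: "(\<integral>\<pi>. (\<Sum>i<b ^ m. h (?u \<pi> i))\<^sup>2 \<partial>?P) \<le> real (b ^ m) * real C" by simp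

  \<comment> \<open>Each interval holds \<open>b\<close> to the power \<open>t\<close> of the
    \<open>b\<close> to the power \<open>m\<close> scrambled points, and this proportion is its
    volume.\<close>
  have exact: "(\<Sum>i<b ^ m. indicator s (?u \<pi> i)) / real (b ^ m) = measure unif s"
    if "s \<in> S" "\<And>i. i < b ^ m \<Longrightarrow> regular_scrambling b \<pi> (x i)" for s \<pi>
  proof (cases "s = UNIV")
    case True
    then show ?thesis using b U.prob_space by simp
  next
    case False
    with that obtain \<kappa> c where s: "s = elem_interval b \<kappa> c" and \<kappa>: "(\<Sum>j\<in>UNIV. \<kappa> j) = m - t"
      and c: "\<And>j. c j < b ^ \<kappa> j" by (auto simp: S_def cells_def PiE_UNIV_eq)
    have "(\<Sum>i<b ^ m. indicator s (?u \<pi> i)) = real (card {i\<in>{..<b ^ m}. ?u \<pi> i \<in> s})"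
      by (simp add: indicator_def sum.If_cases Int_def)
    also have "\<dots> = real (b ^ t)"
      unfolding s using card_scrambled_net[OF b net that(2) \<kappa> c] by simp
    finally have "(\<Sum>i<b ^ m. indicator s (?u \<pi> i)) / real (b ^ m) = 1 / real b ^ (m - t)"
      using b tm by (simp add: power_diff)
    moreover have "emeasure unif s = ennreal (1 / real b ^ (m - t))"
      unfolding s using b c
      by (subst emeasure_unif) (simp_all add: elem_interval_sets elem_interval_subset_unit_cube
          emeasure_lborel_elem_interval \<kappa>)
    ultimately show ?thesis by (simp add: measure_def)
  qed
  have mean: "measure unif A = (\<Sum>r\<in>S. q r * measure unif r)"
  proof -
    have "0 = (\<integral>u. h u * indicator UNIV u \<partial>unif)" using orth[of UNIV] by (simp add: S_def)
    also have "\<dots> = (\<integral>u. indicator A u - (\<Sum>r\<in>S. q r * indicator r u) \<partial>unif)" by (simp add: h_def)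
    also have "\<dots> = measure unif A - (\<Sum>r\<in>S. q r * measure unif r)"
      using S_sets A by (subst Bochner_Integration.integral_diff)
        (auto simp: Bochner_Integration.integral_sum U.emeasure_eq_measure)
    finally show ?thesis by simp
  qed
  have "AE \<pi> in ?P. \<forall>i\<in>{..<b ^ m}. regular_scrambling b \<pi> (x i)"
    by (intro AE_finite_allI AE_regular_scrambling b) auto
  then have "AE \<pi> in ?P. ((\<Sum>i<b ^ m. indicator A (?u \<pi> i)) / real (b ^ m) - measure unif A)\<^sup>2 =
      (\<Sum>i<b ^ m. h (?u \<pi> i))\<^sup>2 / (real (b ^ m))\<^sup>2"
  proof eventually_elim
    case (elim \<pi>)
    have "(\<Sum>i<b ^ m. h (?u \<pi> i)) / real (b ^ m) =
        (\<Sum>i<b ^ m. indicator A (?u \<pi> i)) / real (b ^ m) -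
        (\<Sum>r\<in>S. q r * ((\<Sum>i<b ^ m. indicator r (?u \<pi> i)) / real (b ^ m)))"
      unfolding h_def sum_subtractf diff_divide_distrib
      by (subst sum.swap) (simp only: sum_divide_distrib sum_distrib_left times_divide_eq_right)
    also have "\<dots> = (\<Sum>i<b ^ m. indicator A (?u \<pi> i)) / real (b ^ m) - measure unif A"
      using elim unfolding mean by (simp add: exact del: of_nat_power)
    finally show ?case by (simp add: power_divide[symmetric])
  qed
  then have "(\<integral>\<pi>. ((\<Sum>i<b ^ m. indicator A (?u \<pi> i)) / real (b ^ m) - measure unif A)\<^sup>2 \<partial>?P) =
      (\<integral>\<pi>. (\<Sum>i<b ^ m. h (?u \<pi> i))\<^sup>2 / (real (b ^ m))\<^sup>2 \<partial>?P)"
    by (intro integral_cong_AE) auto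
  also have "\<dots> = (\<integral>\<pi>. (\<Sum>i<b ^ m. h (?u \<pi> i))\<^sup>2 \<partial>?P) / (real (b ^ m))\<^sup>2" by simp
  also have "\<dots> \<le> real (b ^ m) * real C / (real (b ^ m))\<^sup>2"
    by (intro divide_right_mono moment) simp
  also have "\<dots> = real C / real (b ^ m)" using b by (simp add: power2_eq_square)
  finally show ?thesis unfolding C_def .
qed

section \<open>Almost sure convergence\<close>

text \<open>Ratio test: the polynomial factor eventually grows by less than 3/2 per step, while
  division by \<open>b \<ge> 2\<close> at least halves, giving the ratio 3/4.\<close>

lemma summable_polynomial_div_power:
  assumes "2 \<le> b"
  shows "summable (\<lambda>m. real ((m + 1) ^ d * K) / real (b ^ m))"
proof -
  have "(\<lambda>n. (1 + inverse (real (Suc n))) ^ d) \<longlonglongrightarrow> (1 + 0) ^ d"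
    by (intro tendsto_intros LIMSEQ_inverse_real_of_nat)
  then have "\<forall>\<^sub>F n in sequentially. (1 + inverse (real (Suc n))) ^ d < 3 / 2"
    by (rule order_tendstoD(2)) simp
  then obtain N where N: "\<And>n. n \<ge> N \<Longrightarrow> (1 + inverse (real (Suc n))) ^ d < 3 / 2"
    by (auto simp: eventually_sequentially)
  have "summable (\<lambda>m. real (m + 1) ^ d / real b ^ m)"
  proof (rule summable_ratio_test[of "3/4" N])
    fix n assume "n \<ge> N"
    have "real (Suc n + 1) = real (n + 1) * (1 + inverse (real (Suc n)))"
      by (simp add: field_simps)
    then have "real (Suc n + 1) ^ d = real (n + 1) ^ d * (1 + inverse (real (Suc n))) ^ d"
      by (simp only: power_mult_distrib)
    also have "\<dots> \<le> real (n + 1) ^ d * (3 / 2)"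
      using N[OF \<open>n \<ge> N\<close>] by (intro mult_left_mono) auto
    finally have "real (Suc n + 1) ^ d / real b ^ Suc n \<le> real (n + 1) ^ d * (3 / 2) / real b ^ Suc n"
      by (rule divide_right_mono) simp
    also have "\<dots> = (real (n + 1) ^ d / real b ^ n) * ((3 / 2) / real b)" by simp
    also have "\<dots> \<le> (real (n + 1) ^ d / real b ^ n) * (3 / 4)"
      using assms by (intro mult_left_mono) (auto simp: field_simps)
    finally show "norm (real (Suc n + 1) ^ d / real b ^ Suc n) \<le> 3 / 4 * norm (real (n + 1) ^ d / real b ^ n)"
      by (simp add: mult.commute)
  qed simp
  then have "summable (\<lambda>m. real K * (real (m + 1) ^ d / real b ^ m))" by (rule summable_mult)
  then show ?thesis by (simp add: mult.commute)
qed

text \<open>The expected squared errors are summable, so the sum of the squared errors is almost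
  surely finite and its terms tend to 0. Only the law of each single \<open>Perm m\<close>
  enters.\<close>

lemma AE_scrambled_net_mean_tendsto:
  fixes P :: "nat \<Rightarrow> nat \<Rightarrow> real^'d"
  assumes b: "2 \<le> b" and "prob_space M" and net: "\<forall>m\<ge>t. is_net b t m (P m)"
    and Perm: "\<forall>m\<ge>t. Perm m \<in> measurable M (perm_space b) \<and> distr M (perm_space b) (Perm m) = perm_space b"
    and A [measurable]: "A \<in> sets borel"
  shows "AE \<omega> in M. (\<lambda>m. (\<Sum>i<b ^ m. indicator A (scramble b (Perm m \<omega>) (P m i))) / real (b ^ m))
    \<longlonglongrightarrow> measure unif A"
proof -
  interpret M: prob_space M by fact
  interpret U: prob_space "unif :: (real^'d) measure" by (rule prob_space_unif)
  let ?P = "perm_space b :: ('d \<times> nat list \<Rightarrow> nat \<Rightarrow> nat) measure"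
  interpret PS: prob_space ?P by (rule prob_space_perm_space)
  define Y where "Y m \<pi> = ((\<Sum>i<b ^ m. indicator A (scramble b \<pi> (P m i))) / real (b ^ m) - measure unif A)\<^sup>2" for m \<pi>
  have Y_meas [measurable]: "Y m \<in> borel_measurable ?P" for m unfolding Y_def by measurable
  have Y_nonneg: "0 \<le> Y m \<pi>" for m \<pi> by (simp add: Y_def)
  have Y_le: "Y m \<pi> \<le> 1" for m \<pi>
  proof -
    have "(\<Sum>i<b ^ m. indicator A (scramble b \<pi> (P m i))) \<le> (\<Sum>i<b ^ m. 1 :: real)"
      by (intro sum_mono) (simp add: indicator_def)
    then have "(\<Sum>i<b ^ m. indicator A (scramble b \<pi> (P m i))) / real (b ^ m) \<le> 1"
      using b by (simp add: divide_le_eq del: sum_indicator_eq_card)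
    moreover have "0 \<le> (\<Sum>i<b ^ m. indicator A (scramble b \<pi> (P m i))) / real (b ^ m)"
      by (intro divide_nonneg_nonneg sum_nonneg) auto
    moreover have "0 \<le> measure unif A" "measure unif A \<le> 1" by auto
    ultimately have "\<bar>(\<Sum>i<b ^ m. indicator A (scramble b \<pi> (P m i))) / real (b ^ m) - measure unif A\<bar> \<le> 1"
      by linarith
    then show ?thesis unfolding Y_def by (simp add: abs_square_le_1)
  qed
  define C where "C m = real ((m + 1) ^ CARD('d) * (b ^ CARD('d) * b ^ t)) / real (b ^ m)" for m
  have C: "summable C" unfolding C_def by (rule summable_polynomial_div_power[OF b])
  have nn: "(\<integral>\<^sup>+\<omega>. ennreal (Y m (Perm m \<omega>)) \<partial>M) \<le> ennreal (C m)" if "m \<ge> t" for m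
  proof -
    have "(\<integral>\<^sup>+\<omega>. ennreal (Y m (Perm m \<omega>)) \<partial>M) = (\<integral>\<^sup>+\<pi>. ennreal (Y m \<pi>) \<partial>distr M ?P (Perm m))"
      using Perm that by (subst nn_integral_distr) auto
    also have "\<dots> = (\<integral>\<^sup>+\<pi>. ennreal (Y m \<pi>) \<partial>?P)" using Perm that by simp
    also have "\<dots> = ennreal (\<integral>\<pi>. Y m \<pi> \<partial>?P)"
      by (intro nn_integral_eq_integral PS.integrable_const_bound[of _ 1]) (auto simp: Y_nonneg Y_le)
    also have "\<dots> \<le> ennreal (C m)"
      unfolding Y_def C_def using net that by (intro ennreal_leI scrambled_net_second_moment b A) auto
    finally show ?thesis .
  qed
  \<comment> \<open>The index is shifted by \<open>t\<close> because nets and permutations are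
    specified only from \<open>m = t\<close> on.\<close>
  have Perm_meas: "Perm (m + t) \<in> measurable M ?P" for m using Perm by simp
  have YP_meas: "(\<lambda>\<omega>. ennreal (Y (m + t) (Perm (m + t) \<omega>))) \<in> borel_measurable M" for m
    by (rule measurable_compose[OF Perm_meas measurable_compose[OF Y_meas measurable_ennreal]])
  have "(\<integral>\<^sup>+\<omega>. (\<Sum>m. ennreal (Y (m + t) (Perm (m + t) \<omega>))) \<partial>M) =
      (\<Sum>m. \<integral>\<^sup>+\<omega>. ennreal (Y (m + t) (Perm (m + t) \<omega>)) \<partial>M)"
    by (rule nn_integral_suminf[OF YP_meas])
  also have "\<dots> \<le> (\<Sum>m. ennreal (C (m + t)))"
    by (intro suminf_le nn) auto
  also have "\<dots> = ennreal (\<Sum>m. C (m + t))"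
    using C by (intro suminf_ennreal2) (simp_all add: summable_iff_shift, simp add: C_def)
  also have "\<dots> < top" by simp
  finally have "AE \<omega> in M. (\<Sum>m. ennreal (Y (m + t) (Perm (m + t) \<omega>))) \<noteq> \<infinity>"
    by (intro nn_integral_PInf_AE borel_measurable_suminf_order YP_meas) auto
  then show ?thesis
  proof eventually_elim
    case (elim \<omega>)
    then have "summable (\<lambda>m. Y (m + t) (Perm (m + t) \<omega>))"
      using Y_nonneg by (intro summable_suminf_not_top) auto
    then have "(\<lambda>m. Y (m + t) (Perm (m + t) \<omega>)) \<longlonglongrightarrow> 0" by (rule summable_LIMSEQ_zero)
    from tendsto_real_sqrt[OF LIMSEQ_offset[OF this]]
    have "(\<lambda>m. sqrt (Y m (Perm m \<omega>))) \<longlonglongrightarrow> 0" by simp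
    then have "(\<lambda>m. \<bar>(\<Sum>i<b ^ m. indicator A (scramble b (Perm m \<omega>) (P m i))) / real (b ^ m) - measure unif A\<bar>) \<longlonglongrightarrow> 0"
      by (simp add: Y_def)
    then have "(\<lambda>m. (\<Sum>i<b ^ m. indicator A (scramble b (Perm m \<omega>) (P m i))) / real (b ^ m) - measure unif A) \<longlonglongrightarrow> 0"
      by (rule tendsto_rabs_zero_cancel)
    then show ?case by (rule LIM_zero_cancel)
  qed
qed

section \<open>Convergence of quantiles from convergence of distribution functions\<close>

lemma emp_cdf_mono: "y \<le> z \<Longrightarrow> emp_cdf n L y \<le> emp_cdf n L z"
  unfolding emp_cdf_def by (intro divide_right_mono of_nat_mono card_mono) auto

text \<open>The two assumptions make the set bounded below and nonempty, so its \<open>Inf\<close>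
  is a genuine infimum.\<close>

lemma quantile_between:
  assumes "mono F" "F y < \<alpha>" "\<alpha> \<le> F z"
  shows "y \<le> quantile \<alpha> F" "quantile \<alpha> F \<le> z"
proof -
  have lower: "y \<le> w" if "w \<in> {y. \<alpha> \<le> F y}" for w
    using that assms(2) monoD[OF assms(1), of w y] by (cases "y \<le> w") auto
  show "y \<le> quantile \<alpha> F"
    unfolding quantile_def using assms(3) by (intro cInf_greatest lower) auto
  show "quantile \<alpha> F \<le> z"
    unfolding quantile_def using assms(3) lower by (intro cInf_lower bdd_belowI[of _ y]) auto
qed

text \<open>Strict inequalities on both sides of \<open>v\<close> pass to \<open>G n\<close> for
  large \<open>n\<close> and trap its quantile. Countably many test points suffice, which lets the
  null sets of their convergence statements be merged.\<close>

lemma quantile_tendsto: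
  fixes F :: "real \<Rightarrow> real"
  assumes mono: "\<And>n. mono (G n)"
    and conv: "\<And>k. (\<lambda>n. G n (v - inverse (real (Suc k)))) \<longlonglongrightarrow> F (v - inverse (real (Suc k)))"
      "\<And>k. (\<lambda>n. G n (v + inverse (real (Suc k)))) \<longlonglongrightarrow> F (v + inverse (real (Suc k)))"
    and F: "\<And>y. y < v \<Longrightarrow> F y < \<alpha>" "\<And>y. v < y \<Longrightarrow> \<alpha> < F y"
  shows "(\<lambda>n. quantile \<alpha> (G n)) \<longlonglongrightarrow> v"
proof (rule LIMSEQ_I)
  fix r :: real assume "r > 0"
  then obtain k where k: "inverse (real (Suc k)) < r" using reals_Archimedean by blast
  let ?e = "inverse (real (Suc k))"
  have "\<forall>\<^sub>F n in sequentially. G n (v - ?e) < \<alpha>"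
    using conv(1) by (rule order_tendstoD(2)) (simp add: F)
  moreover have "\<forall>\<^sub>F n in sequentially. \<alpha> < G n (v + ?e)"
    using conv(2) by (rule order_tendstoD(1)) (simp add: F)
  ultimately have "\<forall>\<^sub>F n in sequentially. norm (quantile \<alpha> (G n) - v) < r"
  proof eventually_elim
    case (elim n)
    then show ?case
      using quantile_between[OF mono[of n] elim(1), of "v + ?e"] k by auto
  qed
  then show "\<exists>no. \<forall>n\<ge>no. norm (quantile \<alpha> (G n) - v) < r" by (simp add: eventually_sequentially)
qed

lemma One_nth: "(One :: real^'d) $ j = 1"
proof -
  have "axis j (1::real) \<in> Basis" by (auto simp: Basis_vec_def)
  from inner_sum_left_Basis[OF this, of "\<lambda>_. 1"] show ?thesis
    by (simp only: cart_eq_inner_axis scaleR_one)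
qed

lemma box_subset_unit_cube: "box 0 (One :: real^'d) \<subseteq> unit_cube"
  unfolding mem_box_cart subset_iff unit_cube_def One_nth by (simp add: less_imp_le)

lemma AE_unif_box: "AE u in unif. u \<in> box 0 (One :: real^'d)"
proof -
  interpret U: prob_space "unif :: (real^'d) measure" by (rule prob_space_unif)
  have "emeasure unif (box 0 (One :: real^'d)) = emeasure lborel (box 0 (One :: real^'d))"
    by (intro emeasure_unif box_subset_unit_cube) simp
  also have "\<dots> = 1" by (subst emeasure_lborel_box) (auto simp: inner_sum_left_Basis)
  finally have "U.prob (box 0 One) = 1" by (simp add: measure_def)
  then show ?thesis by (subst (asm) U.prob_eq_1) auto
qed

section \<open>The distribution function of the loss\<close>

context
  fixes g :: "real^'d \<Rightarrow> real"
  assumes g: "g \<in> borel_measurable (restrict_space lborel (box 0 One))"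
begin

lemma sublevel_sets: "{u \<in> box 0 One. g u \<le> y} \<in> sets borel"
proof -
  have "{u \<in> space (restrict_space lborel (box 0 One)). g u \<le> y} \<in> sets (restrict_space lborel (box 0 One))"
    using g by measurable
  then show ?thesis by (auto simp: space_restrict_space sets_restrict_space_iff)
qed

lemma unif_cdf_eq_measure: "unif_cdf g y = measure unif {u \<in> box 0 One. g u \<le> y}"
proof -
  let ?A = "{u \<in> box 0 One. g u \<le> y}"
  have "emeasure lborel (box 0 (One :: real^'d)) = 1"
    by (subst emeasure_lborel_box) (auto simp: inner_sum_left_Basis)
  moreover have "box 0 One \<inter> ?A = ?A" by auto
  ultimately have "emeasure (uniform_measure lborel (box 0 One)) ?A = emeasure lborel ?A"
    using sublevel_sets[of y] by (subst emeasure_uniform_measure) (simp_all add: divide_ennreal_def)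
  also have "\<dots> = emeasure unif ?A"
    using box_subset_unit_cube by (intro emeasure_unif[symmetric] sublevel_sets) auto
  finally have "emeasure (uniform_measure lborel (box 0 One)) ?A = emeasure unif ?A" .
  then show ?thesis unfolding unif_cdf_def measure_def by simp
qed

text \<open>Extending \<open>g\<close> by 0 outside the open box changes it on a null set only. As
  the \<open>cdf\<close> of a real distribution, \<open>unif_cdf g\<close> inherits monotonicity,
  the limit at minus infinity and the left limits.\<close>

lemma unif_cdf_eq_cdf: "\<exists>D. real_distribution D \<and> unif_cdf g = cdf D"
proof -
  interpret U: prob_space "unif :: (real^'d) measure" by (rule prob_space_unif)
  define G where "G u = (if u \<in> box 0 One then g u else 0)" for u
  have "G \<in> borel_measurable borel"
  proof -
    have "(\<lambda>u. if u \<in> box 0 One then g u else 0) \<in> borel_measurable lborel"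
      using g by (subst measurable_restrict_space_iff[symmetric]) auto
    then show ?thesis by (simp add: G_def[abs_def])
  qed
  note [measurable] = this
  interpret D: real_distribution "distr unif borel G"
    by (simp add: real_distribution_def real_distribution_axioms_def U.prob_space_distr)
  have "unif_cdf g y = cdf (distr unif borel G) y" for y
  proof -
    have "cdf (distr unif borel G) y = measure unif {u. G u \<le> y}"
      unfolding cdf_def by (subst measure_distr) (auto simp: vimage_def)
    also have "\<dots> = measure unif {u \<in> box 0 One. g u \<le> y}"
    proof (rule U.finite_measure_eq_AE)
      show "AE u in unif. u \<in> {u. G u \<le> y} \<longleftrightarrow> u \<in> {u \<in> box 0 One. g u \<le> y}"
        using AE_unif_box by eventually_elim (simp add: G_def)
    qed (use sublevel_sets[of y] in \<open>auto intro!: borel_measurable_le\<close>)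
    finally show ?thesis by (simp add: unif_cdf_eq_measure)
  qed
  then show ?thesis using D.real_distribution_axioms by blast
qed

text \<open>To the left, the claim is the definition of the quantile as an infimum. To the right, a
  point \<open>y\<close> with value at most \<open>\<alpha>\<close> would, by monotonicity, be a
  second solution of the quantile condition.\<close>

lemma unif_cdf_around_quantile:
  assumes "0 < \<alpha>"
    and uniq: "\<And>x. (left_lim (unif_cdf g) x \<le> \<alpha> \<and> \<alpha> \<le> unif_cdf g x) \<longleftrightarrow> x = quantile \<alpha> (unif_cdf g)"
  shows "y < quantile \<alpha> (unif_cdf g) \<Longrightarrow> unif_cdf g y < \<alpha>"
    and "quantile \<alpha> (unif_cdf g) < y \<Longrightarrow> \<alpha> < unif_cdf g y"
proof -
  obtain D where "real_distribution D" and D: "unif_cdf g = cdf D" using unif_cdf_eq_cdf by blast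
  interpret real_distribution D by fact
  have mono: "cdf D a \<le> cdf D c" if "a \<le> c" for a c using that by (rule cdf_nondecreasing)
  show "unif_cdf g y < \<alpha>" if "y < quantile \<alpha> (unif_cdf g)"
  proof (rule ccontr)
    assume "\<not> unif_cdf g y < \<alpha>"
    then have y: "y \<in> {y. \<alpha> \<le> cdf D y}" by (simp add: D)
    \<comment> \<open>The limit 0 at minus infinity together with \<open>0 < \<alpha>\<close>
      provides the lower bound that makes the infimum meaningful.\<close>
    have "\<forall>\<^sub>F w in at_bot. cdf D w < \<alpha>" using cdf_lim_at_bot assms(1) by (rule order_tendstoD(2))
    then obtain w where w: "cdf D w < \<alpha>" using eventually_happens'[OF trivial_limit_at_bot_linorder] by blast
    have "w \<le> z" if "z \<in> {y. \<alpha> \<le> cdf D y}" for z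
      using that w mono[of z w] by (cases "w \<le> z") auto
    then have "Inf {y. \<alpha> \<le> cdf D y} \<le> y" using y by (intro cInf_lower bdd_belowI[of _ w]) auto
    with that show False by (simp add: quantile_def D)
  qed
  show "\<alpha> < unif_cdf g y" if "quantile \<alpha> (unif_cdf g) < y"
  proof (rule ccontr)
    assume "\<not> \<alpha> < unif_cdf g y"
    then have le: "cdf D y \<le> \<alpha>" by (simp add: D)
    have "\<alpha> \<le> unif_cdf g (quantile \<alpha> (unif_cdf g))" using uniq by blast
    also have "\<dots> \<le> unif_cdf g y" unfolding D using that by (intro mono) (simp add: D)
    finally have "\<alpha> \<le> unif_cdf g y" .
    moreover have "left_lim (unif_cdf g) y \<le> \<alpha>"
    proof -
      have "left_lim (unif_cdf g) y = measure D {..<y}"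
        unfolding left_lim_def D by (intro tendsto_Lim cdf_at_left) simp
      also have "\<dots> \<le> cdf D y" unfolding cdf_def by (intro finite_measure_mono) auto
      finally show ?thesis using le by simp
    qed
    ultimately have "y = quantile \<alpha> (unif_cdf g)" using uniq by blast
    with that show False by simp
  qed
qed

text \<open>The assumption on \<open>g\<close> concerns the open box only. Almost surely all
  scrambled points lie there, and then the empirical distribution function is the net mean of the
  indicator of a Borel sublevel set.\<close>

lemma AE_emp_cdf_tendsto:
  fixes P :: "nat \<Rightarrow> nat \<Rightarrow> real^'d"
  assumes b: "2 \<le> b" and "prob_space M" and net: "\<forall>m\<ge>t. is_net b t m (P m)"
    and Perm: "\<forall>m\<ge>t. Perm m \<in> measurable M (perm_space b) \<and> distr M (perm_space b) (Perm m) = perm_space b"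
  shows "AE \<omega> in M. (\<lambda>m. emp_cdf (b ^ m) (\<lambda>i. g (scramble b (Perm m \<omega>) (P m i))) y)
    \<longlonglongrightarrow> unif_cdf g y"
proof -
  have "AE \<omega> in M. m \<ge> t \<longrightarrow> scramble b (Perm m \<omega>) (P m i) \<in> box 0 One" for m i
  proof (cases "m \<ge> t")
    case True
    have "AE \<pi> in perm_space b. scramble b \<pi> (P m i) \<in> box 0 One"
      by (rule AE_scramble_unif[OF b AE_unif_box]) simp
    moreover have Perm_m: "Perm m \<in> measurable M (perm_space b)" "distr M (perm_space b) (Perm m) = perm_space b"
      using Perm True by auto
    ultimately have "AE \<pi> in distr M (perm_space b) (Perm m). scramble b \<pi> (P m i) \<in> box 0 One"
      by (simp only:)
    from AE_distrD[OF Perm_m(1) this] show ?thesis by simp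
  qed simp
  then have "AE \<omega> in M. \<forall>m i. m \<ge> t \<longrightarrow> scramble b (Perm m \<omega>) (P m i) \<in> box 0 One"
    by (simp add: AE_all_countable)
  moreover note AE_scrambled_net_mean_tendsto[OF assms sublevel_sets[of y]]
  ultimately show ?thesis
  proof eventually_elim
    case (elim \<omega>)
    note in_box = elim(1)
    have "\<forall>\<^sub>F m in sequentially. (\<Sum>i<b ^ m. indicator {u \<in> box 0 One. g u \<le> y} (scramble b (Perm m \<omega>) (P m i))) / real (b ^ m)
        = emp_cdf (b ^ m) (\<lambda>i. g (scramble b (Perm m \<omega>) (P m i))) y"
      using eventually_ge_at_top[of t]
    proof eventually_elim
      case (elim m)
      have "(\<Sum>i<b ^ m. indicator {u \<in> box 0 One. g u \<le> y} (scramble b (Perm m \<omega>) (P m i))) =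
          (\<Sum>i<b ^ m. if g (scramble b (Perm m \<omega>) (P m i)) \<le> y then 1 else 0 :: real)"
        using in_box elim by (intro sum.cong) (auto simp: indicator_def)
      then show ?case by (simp add: emp_cdf_def sum.If_cases Int_def)
    qed
    with elim(2) show ?case unfolding unif_cdf_eq_measure by (rule Lim_transform_eventually)
  qed
qed

end

theorem theorem1:
  fixes \<alpha> :: real and b t :: nat and \<Theta> :: "real set" and \<theta> :: real
    and g :: "real \<Rightarrow> real^'d \<Rightarrow> real"
    and M :: "'w measure"
    and P :: "nat \<Rightarrow> nat \<Rightarrow> real^'d"
    and Perm :: "nat \<Rightarrow> 'w \<Rightarrow> ('d \<times> nat list \<Rightarrow> nat \<Rightarrow> nat)"
  assumes "0 < \<alpha>" and "\<alpha> < 1" and "2 \<le> b"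
    and "\<theta> \<in> \<Theta>"
    and "\<forall>\<theta>\<in>\<Theta>. g \<theta> \<in> borel_measurable (restrict_space lborel (box 0 One))"
    and "\<forall>\<theta>\<in>\<Theta>. \<forall>x. (left_lim (unif_cdf (g \<theta>)) x \<le> \<alpha> \<and> \<alpha> \<le> unif_cdf (g \<theta>) x)
                         \<longleftrightarrow> x = quantile \<alpha> (unif_cdf (g \<theta>))"
    and "prob_space M"
    and "\<forall>m\<ge>t. is_net b t m (P m)"
    and "\<forall>m\<ge>t. Perm m \<in> measurable M (perm_space b) \<and> distr M (perm_space b) (Perm m) = perm_space b"
  shows "AE \<omega> in M.
           (\<lambda>m. quantile \<alpha> (emp_cdf (b ^ m) (\<lambda>i. g \<theta> (scramble b (Perm m \<omega>) (P m i)))))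
             \<longlonglongrightarrow> quantile \<alpha> (unif_cdf (g \<theta>))"
proof -
  have g: "g \<theta> \<in> borel_measurable (restrict_space lborel (box 0 One))" using assms(4,5) by blast
  let ?v = "quantile \<alpha> (unif_cdf (g \<theta>))"
  let ?F = "\<lambda>\<omega> m. emp_cdf (b ^ m) (\<lambda>i. g \<theta> (scramble b (Perm m \<omega>) (P m i)))"
  \<comment> \<open>Pointwise convergence is invoked at countably many points around the quantile,
    so one null set serves them all.\<close>
  have "AE \<omega> in M. \<forall>k. (\<lambda>m. ?F \<omega> m (?v - inverse (real (Suc k)))) \<longlonglongrightarrow> unif_cdf (g \<theta>) (?v - inverse (real (Suc k)))"
    "AE \<omega> in M. \<forall>k. (\<lambda>m. ?F \<omega> m (?v + inverse (real (Suc k)))) \<longlonglongrightarrow> unif_cdf (g \<theta>) (?v + inverse (real (Suc k)))"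
    using AE_emp_cdf_tendsto[OF g assms(3,7-9)] by (simp_all add: AE_all_countable)
  then show ?thesis
  proof eventually_elim
    case (elim \<omega>)
    show ?case
    proof (rule quantile_tendsto[where F="unif_cdf (g \<theta>)"])
      show "mono (?F \<omega> m)" for m by (simp add: mono_def emp_cdf_mono)
      show "y < ?v \<Longrightarrow> unif_cdf (g \<theta>) y < \<alpha>" "?v < y \<Longrightarrow> \<alpha> < unif_cdf (g \<theta>) y" for y
        using unif_cdf_around_quantile[OF g assms(1)] assms(4,6) by blast+
    qed (use elim in blast)+
  qed
qed

end
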